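(* Let $k$ be a fixed positive integer and $\sigma>0$. Let $\{X_n\in\mathbb{R}^{d_n},\,n\ge1\}$ be continuous random vectors satisfying the following conditions, where $\widetilde X_n$ denotes an independent copy of $X_n$: (1) $\|X_n\|^2\to\sigma^2$ in probability as $n\to\infty$; (2) $X_n'\widetilde X_n\to0$ in probability as $n\to\infty$; (3) there exists a positive integer $n_0$ such that $\mathbb{E}[(\det A_{n_0,k})^{-1/2}]<\infty$; (4) for each $n$, $\int_{-\infty}^\infty|\varphi_{X_n}(t\theta)|\,dt<\infty$ for almost all $\theta\in\mathcal{S}^{d_n-1}$. Let $\{\Xi_n\in\mathbb{R}^{d_n},\,n\ge1\}$ be random vectors, independent of $\{X_n,\,n\ge1\}$, that are spherically symmetric with $\mathbb{E}\exp(\mathrm{i}u'\Xi_n)=\psi(\|u\|^2)$ for all $u\in\mathbb{R}^{d_n}$ and all $n\ge1$, where $\psi:[0,\infty)\to\mathbb{R}$ does not depend on $n$. Let $G$ be the distribution function on $[0,\infty)$ with $\psi(t^2)=\int_0^\infty\exp(-t^2v^2/2)\,dG(v)$, $t\in\mathbb{R}$, suppose that $\int_0^\infty v^{-d_n}\,dG(v)<\infty$ for all $n$, and let $V$ be a random variable with distribution function $G$. Let $Y_n=\Xi_n'X_n$, $n\ge1$. Let $1\le j\le k$, let $y,a\in\mathbb{R}$, and let $$c_j=2^{-(j+1)/2}\,\pi^{-j/2}\,j^{3/2}\,\sigma^{-(j+2)}\,\mathbb{E}(V^{-j}).$$ Then there exists $n_j\in\mathbb{N}$ such that, for all $n\ge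 n_j$, $$\Big|\mathbb{E}_{\Xi_n}\Big(\big[F_{Y_n|\Xi_n}(y)-F_{Y_n|\Xi_n}(a)\big]^j\Big)-\mathbb{E}_V\Big(\big[F_{\mathcal{N}_1(0,\sigma^2V^2)}(y)-F_{\mathcal{N}_1(0,\sigma^2V^2)}(a)\big]^j\Big)\Big|\le c_j\,|y-a|^j\,\Big[\mathbb{E}\big\|A_{n,j}-\sigma^2I_j\big\|^2\Big]^{1/2}.$$
   Context: Conventions: vectors are column vectors, $'$ denotes transpose, $\|\cdot\|$ is the Euclidean norm for vectors and the Frobenius norm $\|M\|=[\mathrm{tr}(MM')]^{1/2}$ for matrices. $I_j$ is the $j\times j$ identity matrix. The dimensions $d_1,d_2,\ldots$ form a monotonically increasing sequence of positive integers with $d_n\to\infty$. All random vectors $X_n$, $\Xi_n$ are continuous with continuous density functions, each density being supported on an open subset of $\mathbb{R}^{d_n}$. $\mathcal{S}^{d-1}$ is the unit sphere in $\mathbb{R}^d$. $\varphi_{X_n}(u)=\mathbb{E}\exp(\mathrm{i}u'X_n)$ is the characteristic function of $X_n$. For each positive integer $m$, $A_{n,m}=\big(\widetilde X_{n,i}'\widetilde X_{n,r}\big)_{i,r=1}^m$ is the $m\times m$ Gram matrix of mutually independent copies $\widetilde X_{n,1},\ldots,\widetilde X_{n,m}$ of $X_n$. $F_{Y_n|\Xi_n}(y)=\mathbb{P}(Y_n\le y\mid\Xi_n)$ is the conditional cumulative distribution function of $Y_n$ given $\Xi_n$. $F_{\mathcal{N}_1(0,\sigma^2V^2)}$ is,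 for given $V$, the cumulative distribution function of the one-dimensional normal distribution with mean $0$ and variance $\sigma^2V^2$. $\mathbb{E}_{\Xi_n}$ and $\mathbb{E}_V$ denote expectation with respect to the distributions of $\Xi_n$ and $V$. The existence of $G$ is guaranteed by Schoenberg's theorem. *)

theory Defs
  imports "HOL-Probability.Probability" "Jordan_Normal_Form.Determinant"
begin

hide_const (open) Determinants.det Finite_Cartesian_Product.mat

text \<open>A vector of \<open>\<real>\<^sup>d\<close> is a function in the carrier \<open>{..<d} \<rightarrow>\<^sub>E UNIV\<close>, because the dimension
  varies with \<open>n\<close>.\<close>

abbreviation borel_vec :: "nat \<Rightarrow> (nat \<Rightarrow> real) measure"
  where "borel_vec d \<equiv> \<Pi>\<^sub>M i\<in>{..<d}. borel"

abbreviation lborel_vec :: "nat \<Rightarrow> (nat \<Rightarrow> real) measure"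
  where "lborel_vec d \<equiv> \<Pi>\<^sub>M i\<in>{..<d}. lborel"

abbreviation euclid_top :: "nat \<Rightarrow> (nat \<Rightarrow> real) topology"
  where "euclid_top d \<equiv> product_topology (\<lambda>i. euclideanreal) {..<d}"

definition dot :: "nat \<Rightarrow> (nat \<Rightarrow> real) \<Rightarrow> (nat \<Rightarrow> real) \<Rightarrow> real"
  where "dot d x y = (\<Sum>i<d. x i * y i)"

abbreviation vnorm :: "nat \<Rightarrow> (nat \<Rightarrow> real) \<Rightarrow> real"
  where "vnorm d x \<equiv> L2_set x {..<d}"

definition scale_vec :: "nat \<Rightarrow> real \<Rightarrow> (nat \<Rightarrow> real) \<Rightarrow> (nat \<Rightarrow> real)"
  where "scale_vec d t x = (\<lambda>i\<in>{..<d}. t * x i)"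

definition mat_apply :: "real mat \<Rightarrow> (nat \<Rightarrow> real) \<Rightarrow> (nat \<Rightarrow> real)"
  where "mat_apply Q x = (\<lambda>i\<in>{..<dim_row Q}. \<Sum>l<dim_col Q. Q $$ (i, l) * x l)"

definition unit_sphere :: "nat \<Rightarrow> (nat \<Rightarrow> real) set"
  where "unit_sphere d = {\<theta> \<in> space (borel_vec d). vnorm d \<theta> = 1}"

text \<open>Surface measure: \<open>d\<close> times the Lebesgue measure of the cone
  \<open>{r \<theta> | 0 < r \<le> 1, \<theta> \<in> B}\<close> over \<open>B\<close>.  For \<open>d = 1\<close> this is counting measure on two points.\<close>

definition sphere_measure :: "nat \<Rightarrow> (nat \<Rightarrow> real) measure"
  where "sphere_measure d = scale_measure (of_nat d)
    (distr (restrict_space (lborel_vec d) {x. 0 < vnorm d x \<and> vnorm d x \<le> 1})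
           (restrict_space (borel_vec d) (unit_sphere d))
           (\<lambda>x. scale_vec d (inverse (vnorm d x)) x))"

text \<open>The density is continuous on an open set \<open>U\<close> and vanishes off \<open>U\<close>; it need not be continuous
  across the boundary of \<open>U\<close>.  A density continuous on all of \<open>\<real>\<^sup>d\<close> is the case \<open>U = \<real>\<^sup>d\<close>.\<close>

definition continuous_random_vector :: "'a measure \<Rightarrow> nat \<Rightarrow> ('a \<Rightarrow> nat \<Rightarrow> real) \<Rightarrow> bool"
  where "continuous_random_vector M d X \<longleftrightarrow>
    (\<exists>f U. openin (euclid_top d) U
         \<and> continuous_map (subtopology (euclid_top d) U) euclideanreal f
         \<and> (\<forall>x. 0 \<le> f x) \<and> (\<forall>x\<in>space (borel_vec d) - U. f x = 0)
         \<and> distributed M (lborel_vec d) X (\<lambda>x. ennreal (f x)))"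

definition char_vec :: "'a measure \<Rightarrow> nat \<Rightarrow> ('a \<Rightarrow> nat \<Rightarrow> real) \<Rightarrow> (nat \<Rightarrow> real) \<Rightarrow> complex"
  where "char_vec M d X u = (CLINT \<omega>|M. iexp (dot d u (X \<omega>)))"

definition spherically_symmetric :: "'a measure \<Rightarrow> nat \<Rightarrow> ('a \<Rightarrow> nat \<Rightarrow> real) \<Rightarrow> bool"
  where "spherically_symmetric M d X \<longleftrightarrow>
    (\<forall>Q\<in>carrier_mat d d. Q * transpose_mat Q = 1\<^sub>m d \<longrightarrow>
       distr M (borel_vec d) (\<lambda>\<omega>. mat_apply Q (X \<omega>)) = distr M (borel_vec d) X)"

text \<open>The probability space may depend on \<open>n\<close>.\<close>

definition tendsto_in_prob :: "(nat \<Rightarrow> 'a measure) \<Rightarrow> (nat \<Rightarrow> 'a \<Rightarrow> real) \<Rightarrow> real \<Rightarrow> bool"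
  where "tendsto_in_prob M Z c \<longleftrightarrow>
    (\<forall>\<epsilon>>0. (\<lambda>n. measure (M n) {\<omega>\<in>space (M n). \<bar>Z n \<omega> - c\<bar> > \<epsilon>}) \<longlonglongrightarrow> 0)"

text \<open>The \<open>m\<close> mutually independent copies of \<open>X\<close> are \<open>\<omega> \<mapsto> X (\<omega> i)\<close>, \<open>i < m\<close>, on the \<open>m\<close>-fold
  product of the underlying probability space; the Gram matrix is a random matrix on that space.\<close>

abbreviation (input) copies_space :: "'a measure \<Rightarrow> nat \<Rightarrow> (nat \<Rightarrow> 'a) measure"
  where "copies_space M m \<equiv> \<Pi>\<^sub>M i\<in>{..<m}. M"

definition gram_matrix :: "nat \<Rightarrow> ('a \<Rightarrow> nat \<Rightarrow> real) \<Rightarrow> nat \<Rightarrow> (nat \<Rightarrow> 'a) \<Rightarrow> real mat"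
  where "gram_matrix d X m \<omega> = Matrix.mat m m (\<lambda>(i, r). dot d (X (\<omega> i)) (X (\<omega> r)))"

definition frobenius_norm :: "real mat \<Rightarrow> real"
  where "frobenius_norm A = sqrt (\<Sum>i<dim_row A. (A * transpose_mat A) $$ (i, i))"

text \<open>Distribution functions \<open>G\<close> of probability measures on \<open>[0,\<infinity>)\<close>; integrals \<open>dG\<close> are integrals
  with respect to \<open>interval_measure G\<close>.\<close>

definition distribution_function_nonneg :: "(real \<Rightarrow> real) \<Rightarrow> bool"
  where "distribution_function_nonneg G \<longleftrightarrow>
    mono G \<and> (\<forall>v. continuous (at_right v) G) \<and> (\<forall>v<0. G v = 0) \<and> (G \<longlongrightarrow> 1) at_top"

text \<open>A version of \<open>P (Y \<le> y | \<Xi>)\<close>, as a \<open>\<sigma>(\<Xi>)\<close>-measurable random variable on \<open>M\<close>; the expectation over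
  the law of \<open>\<Xi>\<close> of a function of it is therefore its integral over \<open>M\<close>.\<close>

definition cond_cdf ::
    "'a measure \<Rightarrow> nat \<Rightarrow> ('a \<Rightarrow> nat \<Rightarrow> real) \<Rightarrow> ('a \<Rightarrow> real) \<Rightarrow> real \<Rightarrow> 'a \<Rightarrow> real"
  where "cond_cdf M d \<Xi> Y y =
    real_cond_exp M (vimage_algebra (space M) \<Xi> (borel_vec d)) (indicator {\<omega>\<in>space M. Y \<omega> \<le> y})"

text \<open>The argument \<open>s\<close> is the standard deviation.  The value at \<open>s = 0\<close> is not the cdf of a point mass.\<close>

definition normal_cdf :: "real \<Rightarrow> real \<Rightarrow> real"
  where "normal_cdf s = cdf (density lborel (\<lambda>x. ennreal (normal_density 0 s x)))"

definition ennreal_sqrt :: "ennreal \<Rightarrow> ennreal"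
  where "ennreal_sqrt x = (if x = \<infinity> then \<infinity> else ennreal (sqrt (enn2real x)))"

end

theory Submission
  imports Defs "HOL-Real_Asymp.Real_Asymp"
begin

text \<open>
  The \<open>j\<close>-th moment of the increment of the conditional cdf is the probability that all of
  \<open>\<Xi>'X\<^sub>1, \<dots>, \<Xi>'X\<^sub>j\<close> fall between \<open>a\<close> and \<open>y\<close>. Given the \<open>X\<^sub>i\<close>, this vector has characteristic
  function \<open>t \<mapsto> E exp (- V\<^sup>2 t'At / 2)\<close>, where \<open>A\<close> is the Gram matrix; for the limit \<open>A\<close> is
  replaced by \<open>\<sigma>\<^sup>2 I\<close>. Fourier inversion bounds the difference of the two probabilities by
  \<open>(\<bar>y - a\<bar> / 2\<pi>)\<^sup>j\<close> times the \<open>L\<^sup>1\<close> distance of the characteristic functions, and if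
  \<open>\<parallel>A - \<sigma>\<^sup>2 I\<parallel> \<le> \<delta>\<close> this is at most \<open>L \<parallel>A - \<sigma>\<^sup>2 I\<parallel>\<close> with \<open>L\<close> strictly smaller than
  \<open>c\<^sub>j \<bar>y - a\<bar>\<^sup>j\<close> for small \<open>\<delta>\<close>. The complementary event has a probability \<open>p\<^sub>n\<close> tending to 0, and
  by Chebyshev's inequality it contributes at most
  \<open>2 p\<^sub>n \<le> 2 \<surd>p\<^sub>n (E \<parallel>A - \<sigma>\<^sup>2 I\<parallel>\<^sup>2)\<^sup>1\<^sup>/\<^sup>2 / \<delta>\<close>, which the slack in the constant absorbs for large \<open>n\<close>.
\<close>

section \<open>Fourier representation of a smoothed indicator\<close>

text \<open>For \<open>t \<noteq> 0\<close> this is the integral of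
  \<open>exp (- (\<i> * t * x))\<close> over x from a to y, that is, the Fourier transform of the
  indicator of the interval, signed when \<open>y < a\<close>. At \<open>t = 0\<close> division by
  zero gives 0 instead of \<open>y - a\<close>, which affects only a null set.\<close>

definition kern :: "real \<Rightarrow> real \<Rightarrow> real \<Rightarrow> complex" where
  "kern a y t = (iexp (-(t * a)) - iexp (-(t * y))) / (\<i> * t)"

lemma kern_measurable [measurable]: "kern a y \<in> borel_measurable borel"
  unfolding kern_def by measurable

text \<open>The integral of a unimodular function over an interval is at most the length in norm.
  This is the source of the factor \<open>\<bar>y - a\<bar> ^ j\<close> in the theorem.\<close>

lemma norm_kern_le: "norm (kern a y t) \<le> \<bar>y - a\<bar>"
proof (cases "t = 0")
  case False
  have *: "norm (kern a y t) \<le> y - a" if "a \<le> y" for a y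
    using Levy_Inversion_aux2[of "-y" "-a" t] that False by (simp add: kern_def)
  show ?thesis
  proof (cases "a \<le> y")
    case True then show ?thesis using *[of a y] by simp
  next
    case False
    have "norm (kern a y t) = norm (kern y a t)"
      by (simp add: kern_def norm_divide norm_minus_commute)
    then show ?thesis using *[of y a] False by simp
  qed
qed (simp add: kern_def)

abbreviation std_normal_cdf :: "real \<Rightarrow> real" where
  "std_normal_cdf \<equiv> cdf std_normal_distribution"

lemma cdf_std_normal_affine:
  assumes "s > 0"
  shows "cdf (distr std_normal_distribution borel (\<lambda>x. z + s * x)) c = std_normal_cdf ((c - z) / s)"
proof -
  have "(\<lambda>x. z + s * x) -` {..c} = {..(c - z) / s}"
    using assms by (auto simp: field_simps)
  then show ?thesis
    by (simp add: cdf_def measure_distr)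
qed

lemma measure_std_normal_affine_singleton:
  assumes "s > 0"
  shows "measure (distr std_normal_distribution borel (\<lambda>x. z + s * x)) {c} = 0"
proof -
  have "(\<lambda>x. z + s * x) -` {c} = {(c - z) / s}"
    using assms by (auto simp: field_simps)
  moreover have "emeasure std_normal_distribution {(c - z) / s} = 0"
    by (subst emeasure_density) (auto intro!: nn_integral_null_set)
  ultimately show ?thesis
    by (simp add: emeasure_distr measure_def)
qed

lemma char_std_normal_affine:
  "char (distr std_normal_distribution borel (\<lambda>x. z + s * x)) t = iexp (t * z) * exp (- (s * t)\<^sup>2 / 2)"
proof -
  have "char (distr std_normal_distribution borel (\<lambda>x. z + s * x)) t
      = (CLINT x|std_normal_distribution. iexp (t * z) * iexp (s * t * x))"
    unfolding char_def
    by (subst integral_distr) (auto simp: exp_add[symmetric] algebra_simps simp del: exp_add intro!: Bochner_Integration.integral_cong)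
  also have "\<dots> = iexp (t * z) * char std_normal_distribution (s * t)"
    unfolding char_def by simp
  finally show ?thesis
    by (simp add: char_std_normal_distribution)
qed

lemma integrable_kern_gauss:
  assumes "s > 0"
  shows "integrable lborel (\<lambda>t. kern a y t * (iexp (t * z) * exp (- (s * t)\<^sup>2 / 2)))"
proof (rule Bochner_Integration.integrable_bound)
  have "integrable lborel (\<lambda>t. \<bar>y - a\<bar> * (sqrt (2 * pi * (1/s)\<^sup>2) * normal_density 0 (1/s) t))"
    using assms by (intro integrable_mult_right integrable_normal_density) auto
  also have "(\<lambda>t. \<bar>y - a\<bar> * (sqrt (2 * pi * (1/s)\<^sup>2) * normal_density 0 (1/s) t)) = (\<lambda>t. \<bar>y - a\<bar> * exp (- (s * t)\<^sup>2 / 2))"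
    using assms by (auto simp: normal_density_def fun_eq_iff field_simps)
  finally show "integrable lborel (\<lambda>t. \<bar>y - a\<bar> * exp (- (s * t)\<^sup>2 / 2))" .
  show "AE t in lborel. norm (kern a y t * (iexp (t * z) * exp (- (s * t)\<^sup>2 / 2)))
      \<le> norm (\<bar>y - a\<bar> * exp (- (s * t)\<^sup>2 / 2))"
    by (auto simp: norm_mult norm_kern_le intro!: mult_right_mono)
qed measurable

text \<open>For \<open>a \<le> y\<close> the left side is the probability that
  \<open>z + s * x\<close> with x standard normal falls in \<open>{a<..y}\<close>, so it is an
  indicator smoothed at scale s. Levy inversion of this law, whose characteristic function has a
  Gaussian factor, yields an absolutely convergent integral.\<close>

lemma smoothed_indicator_fourier:
  assumes "s > 0"
  shows "complex_of_real (std_normal_cdf ((y - z) / s) - std_normal_cdf ((a - z) / s))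
    = (CLINT t|lborel. kern a y t / (2 * pi) * exp (- (s * t)\<^sup>2 / 2) * iexp (t * z))"
proof -
  have *: "complex_of_real (std_normal_cdf ((y - z) / s) - std_normal_cdf ((a - z) / s))
    = 1 / (2 * pi) * (CLINT t|lborel. kern a y t * (iexp (t * z) * exp (- (s * t)\<^sup>2 / 2)))"
    if ay: "a \<le> y" for a y
  proof -
    let ?M = "distr std_normal_distribution borel (\<lambda>x. z + s * x)"
    interpret S: prob_space std_normal_distribution
      by (rule prob_space_normal_density) simp
    interpret real_distribution ?M
      by (intro real_distribution.intro real_distribution_axioms.intro S.prob_space_distr) auto
    let ?f = "\<lambda>t. kern a y t * (iexp (t * z) * exp (- (s * t)\<^sup>2 / 2))"
    have int: "integrable lborel ?f" by (rule integrable_kern_gauss[OF assms])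
    have "(\<lambda>n. 1 / (2 * pi) * (CLBINT t=-real n..real n. (iexp (-(t * a)) - iexp (-(t * y))) / (\<i> * t) * char ?M t))
      \<longlonglongrightarrow> complex_of_real (measure ?M {a<..y})"
      using Levy_Inversion[OF ay] measure_std_normal_affine_singleton[OF assms]
      by simp
    also have "(\<lambda>n. (CLBINT t=-real n..real n. (iexp (-(t * a)) - iexp (-(t * y))) / (\<i> * t) * char ?M t))
      = (\<lambda>n. (CLINT t|lborel. indicator {-real n..real n} t *\<^sub>R ?f t))"
      unfolding char_std_normal_affine kern_def[symmetric]
      by (subst interval_integral_Icc) (auto simp: set_lebesgue_integral_def)
    finally have lim1: "(\<lambda>n. 1 / (2 * pi) * (CLINT t|lborel. indicator {-real n..real n} t *\<^sub>R ?f t))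
      \<longlonglongrightarrow> complex_of_real (measure ?M {a<..y})" .
    \<comment> \<open>Inversion only gives a limit of integrals over symmetric intervals. The
      Gaussian factor makes the integrand integrable, so dominated convergence identifies this limit
      with the full integral.\<close>
    have "(\<lambda>n. CLINT t|lborel. indicator {-real n..real n} t *\<^sub>R ?f t) \<longlonglongrightarrow> (CLINT t|lborel. ?f t)"
    proof (rule integral_dominated_convergence[where w="\<lambda>t. norm (?f t)"])
      show "AE t in lborel. (\<lambda>n. indicator {-real n..real n} t *\<^sub>R ?f t) \<longlonglongrightarrow> ?f t"
      proof (rule AE_I2)
        fix t :: real
        have "eventually (\<lambda>n. indicator {-real n..real n} t *\<^sub>R ?f t = ?f t) sequentially"
          using eventually_ge_at_top[of "nat \<lceil>\<bar>t\<bar>\<rceil>"]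
          by eventually_elim (auto simp: indicator_def)
        then show "(\<lambda>n. indicator {-real n..real n} t *\<^sub>R ?f t) \<longlonglongrightarrow> ?f t"
          by (rule tendsto_eventually)
      qed
      show "AE t in lborel. norm (indicator {-real n..real n} t *\<^sub>R ?f t) \<le> norm (?f t)" for n
        by (auto simp: indicator_def)
    qed (use int in auto)
    from tendsto_mult_left[OF this, of "1 / (2 * pi)"]
    have "complex_of_real (measure ?M {a<..y}) = 1 / (2 * pi) * (CLINT t|lborel. ?f t)"
      using LIMSEQ_unique[OF lim1] by simp
    moreover have "measure ?M {a<..y} = std_normal_cdf ((y - z) / s) - std_normal_cdf ((a - z) / s)"
      using cdf_diff_eq[of a y] ay cdf_std_normal_affine[OF assms, of z] by (cases "a = y") auto
    ultimately show ?thesis by simp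
  qed
  have "complex_of_real (std_normal_cdf ((y - z) / s) - std_normal_cdf ((a - z) / s))
    = 1 / (2 * pi) * (CLINT t|lborel. kern a y t * (iexp (t * z) * exp (- (s * t)\<^sup>2 / 2)))"
  proof (cases "a \<le> y")
    case False
    \<comment> \<open>Both sides of the identity change sign when a and y are exchanged.\<close>
    have "kern a y = (\<lambda>t. - kern y a t)"
      by (auto simp: kern_def fun_eq_iff minus_divide_left)
    then have "(CLINT t|lborel. kern a y t * (iexp (t * z) * exp (- (s * t)\<^sup>2 / 2)))
      = - (CLINT t|lborel. kern y a t * (iexp (t * z) * exp (- (s * t)\<^sup>2 / 2)))"
      by (simp flip: Bochner_Integration.integral_minus)
    moreover have "complex_of_real (std_normal_cdf ((y - z) / s) - std_normal_cdf ((a - z) / s))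
      = - complex_of_real (std_normal_cdf ((a - z) / s) - std_normal_cdf ((y - z) / s))"
      by simp
    ultimately show ?thesis
      using False by (simp only: *[of y a] mult_minus_right linear le_cases)
  qed (rule *)
  also have "\<dots> = (CLINT t|lborel. 1 / (2 * pi) * (kern a y t * (iexp (t * z) * exp (- (s * t)\<^sup>2 / 2))))"
    by simp
  finally show ?thesis
    by (simp add: mult_ac)
qed

text \<open>The shift \<open>1/m\<close> dominates the width \<open>1/m\<^sup>2\<close>, so the pointwise limit is right also at the
  end points.\<close>

definition smooth_ind :: "nat \<Rightarrow> real \<Rightarrow> real \<Rightarrow> real \<Rightarrow> real" where
  "smooth_ind m a y z = std_normal_cdf ((y + inverse (real (Suc m)) - z) / inverse (real (Suc m) ^ 2))
     - std_normal_cdf ((a + inverse (real (Suc m)) - z) / inverse (real (Suc m) ^ 2))"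

text \<open>A difference of half-line indicators is signed: for \<open>y < a\<close> it is minus the
  indicator of \<open>{y<..a}\<close>. Its expectation is thus always the difference of the
  distribution function values at y and a, and the end points need no ordering.\<close>

definition cdf_step :: "real \<Rightarrow> real \<Rightarrow> real \<Rightarrow> real" where
  "cdf_step a y z = indicat_real {..y} z - indicat_real {..a} z"

lemma smooth_ind_tendsto: "(\<lambda>m. smooth_ind m a y z) \<longlonglongrightarrow> cdf_step a y z"
proof -
  interpret real_distribution std_normal_distribution by (rule real_dist_normal_dist)
  have "(\<lambda>m. std_normal_cdf ((c + inverse (real (Suc m)) - z) / inverse (real (Suc m) ^ 2)))
    \<longlonglongrightarrow> indicat_real {..c} z" for c
  proof (cases "z \<le> c")
    case True
    have "filterlim (\<lambda>m. (c + inverse (real (Suc m)) - z) / inverse (real (Suc m) ^ 2)) at_top sequentially"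
    proof (rule filterlim_at_top_mono[OF filterlim_real_sequentially], rule always_eventually, rule allI)
      fix m
      have "real m \<le> real (Suc m)" by simp
      also have "\<dots> = inverse (real (Suc m)) / inverse (real (Suc m) ^ 2)"
        by (simp add: power2_eq_square field_simps del: of_nat_Suc)
      also have "\<dots> \<le> (c + inverse (real (Suc m)) - z) / inverse (real (Suc m) ^ 2)"
        using True by (intro divide_right_mono) auto
      finally show "real m \<le> (c + inverse (real (Suc m)) - z) / inverse (real (Suc m) ^ 2)" .
    qed
    from filterlim_compose[OF cdf_lim_at_top_prob this] True show ?thesis by simp
  next
    case False
    have "filterlim (\<lambda>m. (c + inverse (real (Suc m)) - z) / inverse (real (Suc m) ^ 2)) at_bot sequentially"
      using False by real_asymp
    from filterlim_compose[OF cdf_lim_at_bot this] False show ?thesis by simp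
  qed
  then show ?thesis unfolding smooth_ind_def cdf_step_def by (intro tendsto_diff)
qed

lemma abs_smooth_ind_le: "\<bar>smooth_ind m a y z\<bar> \<le> 1"
proof -
  interpret real_distribution std_normal_distribution by (rule real_dist_normal_dist)
  have "0 \<le> std_normal_cdf u \<and> std_normal_cdf u \<le> 1" for u
    by (simp add: cdf_nonneg cdf_bounded_prob)
  then show ?thesis unfolding smooth_ind_def by (smt (verit))
qed

lemma abs_step_le: "\<bar>cdf_step a y z\<bar> \<le> 1"
  by (auto simp: cdf_step_def indicator_def)

lemma step_measurable [measurable]: "cdf_step a y \<in> borel_measurable borel"
  unfolding cdf_step_def by measurable

lemma smooth_ind_measurable [measurable]: "smooth_ind m a y \<in> borel_measurable borel"
proof -
  interpret real_distribution std_normal_distribution by (rule real_dist_normal_dist)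
  have [measurable]: "std_normal_cdf \<in> borel_measurable borel"
    by (intro borel_measurable_mono monoI cdf_nondecreasing)
  show ?thesis unfolding smooth_ind_def by measurable
qed

definition smooth_kern :: "nat \<Rightarrow> real \<Rightarrow> real \<Rightarrow> real \<Rightarrow> complex" where
  "smooth_kern m a y t = kern (a + inverse (real (Suc m))) (y + inverse (real (Suc m))) t / (2 * pi)
     * exp (- (inverse (real (Suc m) ^ 2) * t)\<^sup>2 / 2)"

lemma smooth_kern_measurable [measurable]: "smooth_kern m a y \<in> borel_measurable borel"
  unfolding smooth_kern_def by measurable

text \<open>The shift of the end points cancels in their difference and the Gaussian factor is at
  most 1. The bound is therefore uniform in m and survives the limit that removes the
  smoothing.\<close>

lemma norm_smooth_kern_le: "norm (smooth_kern m a y t) \<le> \<bar>y - a\<bar> / (2 * pi)"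
proof -
  have "norm (smooth_kern m a y t) \<le> norm (kern (a + inverse (real (Suc m))) (y + inverse (real (Suc m))) t / (2 * pi)) * 1"
    unfolding smooth_kern_def norm_mult by (intro mult_left_mono) auto
  also have "\<dots> \<le> \<bar>y - a\<bar> / (2 * pi)"
    using norm_kern_le[of "a + inverse (real (Suc m))" "y + inverse (real (Suc m))" t]
    by (auto simp: norm_divide norm_mult intro!: divide_right_mono)
  finally show ?thesis .
qed

lemma smooth_ind_fourier:
  "complex_of_real (smooth_ind m a y z) = (CLINT t|lborel. smooth_kern m a y t * iexp (t * z))"
  unfolding smooth_ind_def smooth_kern_def
  by (rule smoothed_indicator_fourier) simp

lemma integrable_smooth_kern: "integrable lborel (smooth_kern m a y)"
proof -
  have "integrable lborel (\<lambda>t. 1 / (2 * pi) * (kern (a + inverse (real (Suc m))) (y + inverse (real (Suc m))) t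
     * (iexp (t * 0) * exp (- (inverse (real (Suc m) ^ 2) * t)\<^sup>2 / 2))))"
    by (intro integrable_mult_right integrable_kern_gauss) auto
  also have "(\<lambda>t. 1 / (2 * pi) * (kern (a + inverse (real (Suc m))) (y + inverse (real (Suc m))) t
     * (iexp (t * 0) * exp (- (inverse (real (Suc m) ^ 2) * t)\<^sup>2 / 2)))) = smooth_kern m a y"
    by (auto simp: smooth_kern_def fun_eq_iff)
  finally show ?thesis .
qed

section \<open>Comparison of laws through characteristic functions\<close>

text \<open>The one-dimensional representations are multiplied into one integral over t, and Fubini
  moves the expectation inside, where the joint characteristic function of the \<open>Z i\<close>
  appears. The smoothing supplies the integrable kernel that this exchange relies on.\<close>

lemma smooth_product_fourier:
  assumes "prob_space P" and Z[measurable]: "\<And>i. i < j \<Longrightarrow> Z i \<in> borel_measurable P"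
  shows "complex_of_real (LINT \<omega>|P. (\<Prod>i<j. smooth_ind m a y (Z i \<omega>)))
    = (CLINT t|lborel_vec j. (\<Prod>i<j. smooth_kern m a y (t i)) * (CLINT \<omega>|P. iexp (\<Sum>i<j. t i * Z i \<omega>)))"
    and "integrable (lborel_vec j) (\<lambda>t. (\<Prod>i<j. smooth_kern m a y (t i)) * (CLINT \<omega>|P. iexp (\<Sum>i<j. t i * Z i \<omega>)))"
proof -
  interpret P: prob_space P by fact
  interpret L: product_sigma_finite "\<lambda>i::nat. lborel :: real measure" by standard
  interpret L: sigma_finite_measure "lborel_vec j" by (rule L.sigma_finite) simp
  interpret pair_sigma_finite "lborel_vec j" P ..
  let ?K = "\<lambda>t. \<Prod>i<j. smooth_kern m a y (t i)"
  let ?e = "\<lambda>t \<omega>. iexp (\<Sum>i<j. t i * Z i \<omega>)"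
  have K: "integrable (lborel_vec j) ?K"
    by (intro L.product_integrable_prod integrable_smooth_kern) simp
  have e: "integrable P (?e t)" for t
    by (rule P.integrable_const_bound[where B=1]) auto
  \<comment> \<open>The exponential is unimodular and P has mass 1, so integrability on the product
    reduces to that of the kernel in t.\<close>
  have joint: "integrable (lborel_vec j \<Otimes>\<^sub>M P) (\<lambda>(t, \<omega>). ?K t * ?e t \<omega>)"
  proof (rule Fubini_integrable)
    show "(\<lambda>(t, \<omega>). ?K t * ?e t \<omega>) \<in> borel_measurable (lborel_vec j \<Otimes>\<^sub>M P)"
      by measurable
    show "integrable (lborel_vec j) (\<lambda>t. LINT \<omega>|P. norm (case (t, \<omega>) of (t, \<omega>) \<Rightarrow> ?K t * ?e t \<omega>))"
      using K by (simp add: norm_mult P.prob_space)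
    show "AE t in lborel_vec j. integrable P (\<lambda>\<omega>. case (t, \<omega>) of (t, \<omega>) \<Rightarrow> ?K t * ?e t \<omega>)"
      using e by auto
  qed
  have "complex_of_real (LINT \<omega>|P. (\<Prod>i<j. smooth_ind m a y (Z i \<omega>)))
      = (CLINT \<omega>|P. (\<Prod>i<j. CLINT u|lborel. smooth_kern m a y u * iexp (u * Z i \<omega>)))"
    by (simp only: integral_complex_of_real[symmetric] of_real_prod smooth_ind_fourier)
  also have "\<dots> = (CLINT \<omega>|P. CLINT t|lborel_vec j. ?K t * ?e t \<omega>)"
  proof (rule Bochner_Integration.integral_cong[OF refl])
    fix \<omega>
    have "integrable lborel (\<lambda>u. smooth_kern m a y u * iexp (u * c))" for c
      by (rule Bochner_Integration.integrable_bound[OF integrable_smooth_kern[of m a y]])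
        (auto simp: norm_mult)
    then have "(\<Prod>i<j. CLINT u|lborel. smooth_kern m a y u * iexp (u * Z i \<omega>))
      = (CLINT t|lborel_vec j. (\<Prod>i<j. smooth_kern m a y (t i) * iexp (t i * Z i \<omega>)))"
      by (subst L.product_integral_prod) auto
    also have "(\<lambda>t. \<Prod>i<j. smooth_kern m a y (t i) * iexp (t i * Z i \<omega>)) = (\<lambda>t. ?K t * ?e t \<omega>)"
      by (simp add: prod.distrib exp_sum[symmetric] sum_distrib_left)
    finally show "(\<Prod>i<j. CLINT u|lborel. smooth_kern m a y u * iexp (u * Z i \<omega>))
      = (CLINT t|lborel_vec j. ?K t * ?e t \<omega>)" .
  qed
  also have "\<dots> = (CLINT t|lborel_vec j. CLINT \<omega>|P. ?K t * ?e t \<omega>)"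
    using joint by (rule Fubini_integral)
  finally show "complex_of_real (LINT \<omega>|P. (\<Prod>i<j. smooth_ind m a y (Z i \<omega>)))
    = (CLINT t|lborel_vec j. ?K t * (CLINT \<omega>|P. ?e t \<omega>))"
    by simp
  show "integrable (lborel_vec j) (\<lambda>t. ?K t * (CLINT \<omega>|P. ?e t \<omega>))"
    using integrable_fst[OF joint] by simp
qed

lemma expectation_smooth_tendsto:
  assumes "prob_space P" and Z[measurable]: "\<And>i. i < j \<Longrightarrow> Z i \<in> borel_measurable P"
  shows "(\<lambda>m. LINT \<omega>|P. (\<Prod>i<j. smooth_ind m a y (Z i \<omega>))) \<longlonglongrightarrow> (LINT \<omega>|P. (\<Prod>i<j. cdf_step a y (Z i \<omega>)))"
proof (rule integral_dominated_convergence[where w="\<lambda>_. 1"])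
  interpret prob_space P by fact
  show "integrable P (\<lambda>_. 1::real)" by simp
  show "AE \<omega> in P. (\<lambda>m. \<Prod>i<j. smooth_ind m a y (Z i \<omega>)) \<longlonglongrightarrow> (\<Prod>i<j. cdf_step a y (Z i \<omega>))"
    by (intro AE_I2 tendsto_prod smooth_ind_tendsto)
  show "AE \<omega> in P. norm (\<Prod>i<j. smooth_ind m a y (Z i \<omega>)) \<le> 1" for m
    by (intro AE_I2) (auto simp: abs_prod abs_smooth_ind_le intro!: prod_le_1)
qed measurable

text \<open>The Fourier representations of the two smoothed expectations are subtracted, the kernel
  is bounded uniformly in m, and then m tends to infinity. Stating the bound in
  \<open>ennreal\<close> allows the \<open>L\<^sup>1\<close> distance of the characteristic
  functions to be infinite.\<close>

lemma step_expectation_diff_le_char_diff: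
  assumes P: "prob_space P" and Z: "\<And>i. i < j \<Longrightarrow> Z i \<in> borel_measurable P"
    and P': "prob_space P'" and Z': "\<And>i. i < j \<Longrightarrow> Z' i \<in> borel_measurable P'"
  shows "ennreal \<bar>(LINT \<omega>|P. (\<Prod>i<j. cdf_step a y (Z i \<omega>))) - (LINT \<omega>|P'. (\<Prod>i<j. cdf_step a y (Z' i \<omega>)))\<bar>
    \<le> ennreal ((\<bar>y - a\<bar> / (2 * pi)) ^ j) * (\<integral>\<^sup>+t. ennreal (norm ((CLINT \<omega>|P. iexp (\<Sum>i<j. t i * Z i \<omega>))
          - (CLINT \<omega>|P'. iexp (\<Sum>i<j. t i * Z' i \<omega>)))) \<partial>lborel_vec j)"
    (is "_ \<le> ?R")
proof -
  let ?phi = "\<lambda>t. CLINT \<omega>|P. iexp (\<Sum>i<j. t i * Z i \<omega>)"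
  let ?phi' = "\<lambda>t. CLINT \<omega>|P'. iexp (\<Sum>i<j. t i * Z' i \<omega>)"
  let ?D = "\<lambda>m. (LINT \<omega>|P. (\<Prod>i<j. smooth_ind m a y (Z i \<omega>))) - (LINT \<omega>|P'. (\<Prod>i<j. smooth_ind m a y (Z' i \<omega>)))"
  let ?K = "\<lambda>m t. \<Prod>i<j. smooth_kern m a y (t i)"
  have bound: "ennreal \<bar>?D m\<bar> \<le> ?R" for m
  proof -
    note F = smooth_product_fourier[where j=j and Z=Z and m=m and a=a and y=y, OF P]
      smooth_product_fourier[where j=j and Z=Z' and m=m and a=a and y=y, OF P']
    have int: "integrable (lborel_vec j) (\<lambda>t. ?K m t * ?phi t)" "integrable (lborel_vec j) (\<lambda>t. ?K m t * ?phi' t)"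
      using F(2)[OF Z] F(4)[OF Z'] by blast+
    have "complex_of_real (?D m) = (CLINT t|lborel_vec j. ?K m t * ?phi t) - (CLINT t|lborel_vec j. ?K m t * ?phi' t)"
      using F(1)[OF Z] F(3)[OF Z'] by (simp only: of_real_diff)
    also have "\<dots> = (CLINT t|lborel_vec j. ?K m t * ?phi t - ?K m t * ?phi' t)"
      by (rule Bochner_Integration.integral_diff[symmetric, OF int])
    finally have eq: "complex_of_real (?D m) = (CLINT t|lborel_vec j. ?K m t * ?phi t - ?K m t * ?phi' t)" .
    have "ennreal \<bar>?D m\<bar> = ennreal (norm (CLINT t|lborel_vec j. ?K m t * ?phi t - ?K m t * ?phi' t))"
      unfolding eq[symmetric] norm_of_real ..
    also have "\<dots> \<le> (\<integral>\<^sup>+t. ennreal (norm (?K m t * ?phi t - ?K m t * ?phi' t)) \<partial>lborel_vec j)"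
      by (intro integral_norm_bound_ennreal Bochner_Integration.integrable_diff int)
    also have "\<dots> \<le> (\<integral>\<^sup>+t. ennreal ((\<bar>y - a\<bar> / (2 * pi)) ^ j) * ennreal (norm (?phi t - ?phi' t)) \<partial>lborel_vec j)"
    proof (rule nn_integral_mono)
      fix t
      have "norm (?K m t) \<le> (\<Prod>i<j. \<bar>y - a\<bar> / (2 * pi))"
        unfolding prod_norm[symmetric] by (intro prod_mono) (auto simp: norm_smooth_kern_le)
      then have "norm (?K m t * ?phi t - ?K m t * ?phi' t) \<le> (\<bar>y - a\<bar> / (2 * pi)) ^ j * norm (?phi t - ?phi' t)"
        by (simp add: right_diff_distrib[symmetric] norm_mult mult_right_mono)
      then show "ennreal (norm (?K m t * ?phi t - ?K m t * ?phi' t)) \<le> ennreal ((\<bar>y - a\<bar> / (2 * pi)) ^ j) * ennreal (norm (?phi t - ?phi' t))"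
        by (simp add: ennreal_mult[symmetric] ennreal_leI)
    qed
    also have "\<dots> = ?R"
    proof (rule nn_integral_cmult)
      interpret P: prob_space P by fact
      interpret P': prob_space P' by fact
      note [measurable] = Z Z'
      show "(\<lambda>t. ennreal (norm (?phi t - ?phi' t))) \<in> borel_measurable (lborel_vec j)"
        by measurable
    qed
    finally show ?thesis .
  qed
  have lim: "(\<lambda>m. ennreal \<bar>?D m\<bar>) \<longlonglongrightarrow> ennreal \<bar>(LINT \<omega>|P. (\<Prod>i<j. cdf_step a y (Z i \<omega>))) - (LINT \<omega>|P'. (\<Prod>i<j. cdf_step a y (Z' i \<omega>)))\<bar>"
    by (intro tendsto_ennrealI tendsto_rabs tendsto_diff expectation_smooth_tendsto assms)
  show ?thesis
    by (rule LIMSEQ_le_const2[OF lim]) (use bound in blast)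
qed

section \<open>Gaussian integrals and the normal distribution function\<close>

lemma nn_integral_power_gauss:
  assumes "s > 0"
  shows "(\<integral>\<^sup>+x. ennreal (x ^ (2 * k) * exp (- s\<^sup>2 * x\<^sup>2 / 2)) \<partial>lborel) = ennreal (sqrt (2 * pi) / s * (fact (2 * k) / ((2 * s\<^sup>2) ^ k * fact k)))"
proof -
  have "has_bochner_integral lborel (\<lambda>x. sqrt (2 * pi) / s * (normal_density 0 (1/s) x * (x - 0) ^ (2 * k)))
     (sqrt (2 * pi) / s * (fact (2 * k) / ((2 / (1/s)\<^sup>2) ^ k * fact k)))"
    using assms by (intro has_bochner_integral_mult_right normal_moment_even) auto
  also have "(\<lambda>x. sqrt (2 * pi) / s * (normal_density 0 (1/s) x * (x - 0) ^ (2 * k))) = (\<lambda>x. x ^ (2 * k) * exp (- s\<^sup>2 * x\<^sup>2 / 2))"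
    using assms by (auto simp: normal_density_def fun_eq_iff real_sqrt_divide field_simps)
  finally show ?thesis
    by (subst nn_integral_eq_integral) (auto simp: has_bochner_integral_iff power_divide zero_le_even_power)
qed

text \<open>Each of the j summands factorises over the coordinates: coordinate i contributes a
  second moment, hence the extra \<open>1 / s\<^sup>2\<close>, and every coordinate contributes the
  total mass \<open>sqrt (2 * pi) / s\<close>.\<close>

lemma nn_integral_sq_norm_gauss:
  assumes "s > 0"
  shows "(\<integral>\<^sup>+t. ennreal ((\<Sum>i<j. (t i)\<^sup>2) * exp (- s\<^sup>2 * (\<Sum>i<j. (t i)\<^sup>2) / 2)) \<partial>lborel_vec j)
    = ennreal (real j * (sqrt (2 * pi) / s) ^ j / s\<^sup>2)"
proof -
  interpret L: product_sigma_finite "\<lambda>i::nat. lborel :: real measure" by standard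
  \<comment> \<open>The exponent is 2 at \<open>l = i\<close> and 0 elsewhere, which writes
    \<open>(t i)\<^sup>2\<close> as a product over all coordinates.\<close>
  let ?h = "\<lambda>i l x. ennreal (x ^ (2 * (if l = i then 1 else 0)) * exp (- s\<^sup>2 * x\<^sup>2 / 2))"
  have eq: "ennreal ((\<Sum>i<j. (t i)\<^sup>2) * exp (- s\<^sup>2 * (\<Sum>i<j. (t i)\<^sup>2) / 2)) = (\<Sum>i<j. \<Prod>l<j. ?h i l (t l))" for t :: "nat \<Rightarrow> real"
  proof -
    have "(\<Sum>i<j. \<Prod>l<j. ?h i l (t l)) = (\<Sum>i<j. ennreal (\<Prod>l<j. (t l) ^ (2 * (if l = i then 1 else 0)) * exp (- s\<^sup>2 * (t l)\<^sup>2 / 2)))"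
      by (intro sum.cong refl prod_ennreal) (auto simp: zero_le_even_power)
    also have "\<dots> = ennreal (\<Sum>i<j. \<Prod>l<j. (t l) ^ (2 * (if l = i then 1 else 0)) * exp (- s\<^sup>2 * (t l)\<^sup>2 / 2))"
      by (intro sum_ennreal prod_nonneg) (auto simp: zero_le_even_power)
    also have "(\<Sum>i<j. \<Prod>l<j. (t l) ^ (2 * (if l = i then 1 else 0)) * exp (- s\<^sup>2 * (t l)\<^sup>2 / 2))
      = (\<Sum>i<j. (t i)\<^sup>2 * exp (- s\<^sup>2 * (\<Sum>i<j. (t i)\<^sup>2) / 2))"
    proof (rule sum.cong[OF refl])
      fix i assume "i \<in> {..<j}"
      then have "(\<Prod>l<j. (t l) ^ (2 * (if l = i then 1 else 0))) = (t i)\<^sup>2"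
        by (simp add: if_distrib[of "\<lambda>k. 2 * k"] if_distrib[of "\<lambda>k. _ ^ k"] prod.delta cong: if_cong)
      then show "(\<Prod>l<j. (t l) ^ (2 * (if l = i then 1 else 0)) * exp (- s\<^sup>2 * (t l)\<^sup>2 / 2))
        = (t i)\<^sup>2 * exp (- s\<^sup>2 * (\<Sum>i<j. (t i)\<^sup>2) / 2)"
        by (simp add: prod.distrib exp_sum[symmetric] sum_distrib_left sum_divide_distrib sum_negf)
    qed
    finally show ?thesis by (simp add: sum_distrib_right)
  qed
  have "(\<integral>\<^sup>+t. (\<Sum>i<j. \<Prod>l<j. ?h i l (t l)) \<partial>lborel_vec j) = (\<Sum>i<j. \<integral>\<^sup>+t. (\<Prod>l<j. ?h i l (t l)) \<partial>lborel_vec j)"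
    by (rule nn_integral_sum) measurable
  also have "\<dots> = (\<Sum>i<j. ennreal ((sqrt (2 * pi) / s) ^ j / s\<^sup>2))"
  proof (rule sum.cong[OF refl])
    fix i assume i: "i \<in> {..<j}"
    have "(\<integral>\<^sup>+t. (\<Prod>l<j. ?h i l (t l)) \<partial>lborel_vec j) = (\<Prod>l<j. \<integral>\<^sup>+x. ?h i l x \<partial>lborel)"
      by (rule L.product_nn_integral_prod) auto
    also have "\<dots> = (\<Prod>l<j. ennreal (sqrt (2 * pi) / s * (if l = i then 1 / s\<^sup>2 else 1)))"
    proof (rule prod.cong[OF refl])
      fix l
      show "(\<integral>\<^sup>+x. ?h i l x \<partial>lborel) = ennreal (sqrt (2 * pi) / s * (if l = i then 1 / s\<^sup>2 else 1))"
        using nn_integral_power_gauss[OF assms, of "if l = i then 1 else 0"] by (cases "l = i") auto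
    qed
    also have "\<dots> = ennreal (\<Prod>l<j. sqrt (2 * pi) / s * (if l = i then 1 / s\<^sup>2 else 1))"
      using assms by (intro prod_ennreal) auto
    also have "(\<Prod>l<j. sqrt (2 * pi) / s * (if l = i then 1 / s\<^sup>2 else 1)) = (sqrt (2 * pi) / s) ^ j / s\<^sup>2"
      using i by (subst prod.distrib) (simp add: prod.delta)
    finally show "(\<integral>\<^sup>+t. (\<Prod>l<j. ?h i l (t l)) \<partial>lborel_vec j) = ennreal ((sqrt (2 * pi) / s) ^ j / s\<^sup>2)" .
  qed
  also have "\<dots> = ennreal (\<Sum>i<j. (sqrt (2 * pi) / s) ^ j / s\<^sup>2)"
    using assms by (intro sum_ennreal) auto
  finally show ?thesis
    unfolding eq by simp
qed

text \<open>This follows from \<open>1 - exp (- h) \<le> h\<close> after factoring out the larger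
  exponential. Keeping \<open>exp (- r)\<close> preserves the decay needed to integrate over all
  t.\<close>

lemma abs_exp_minus_diff_le:
  fixes p q r :: real
  assumes "r \<le> p" "r \<le> q"
  shows "\<bar>exp (- p) - exp (- q)\<bar> \<le> \<bar>p - q\<bar> * exp (- r)"
proof -
  have *: "\<bar>exp (- p) - exp (- q)\<bar> \<le> \<bar>p - q\<bar> * exp (- r)" if "r \<le> p" "p \<le> q" for p q :: real
  proof -
    have "exp (- p) - exp (- q) = exp (- p) * (1 - exp (p - q))"
      by (simp add: right_diff_distrib exp_add[symmetric])
    also have "\<dots> \<le> exp (- r) * (q - p)"
    proof (rule mult_mono)
      show "1 - exp (p - q) \<le> q - p"
        using exp_ge_add_one_self[of "p - q"] by linarith
    qed (use that in auto)
    finally show ?thesis using that by (simp add: mult.commute)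
  qed
  show ?thesis
    using *[of p q] *[of q p] assms by (cases "p \<le> q") (auto simp: abs_minus_commute)
qed

lemma normal_cdf_eq_expectation:
  assumes "s > 0"
  shows "normal_cdf s c = (LINT x|std_normal_distribution. indicat_real {..c} (s * x))"
proof -
  interpret S: prob_space std_normal_distribution
    by (rule prob_space_normal_density) simp
  have "distributed std_normal_distribution lborel (\<lambda>x. x) (\<lambda>x. ennreal (normal_density 0 1 x))"
    by (auto simp: distributed_def distr_id2)
  from S.normal_density_affine[OF this, of s 0] assms
  have "distr std_normal_distribution lborel (\<lambda>x. s * x) = density lborel (\<lambda>x. ennreal (normal_density 0 s x))"
    by (auto simp: distributed_def)
  then have "normal_cdf s c = measure (distr std_normal_distribution lborel (\<lambda>x. s * x)) {..c}"
    by (simp add: normal_cdf_def cdf_def)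
  also have "\<dots> = (LINT x|distr std_normal_distribution lborel (\<lambda>x. s * x). indicat_real {..c} x)"
    by simp
  also have "\<dots> = (LINT x|std_normal_distribution. indicat_real {..c} (s * x))"
    by (rule integral_distr) auto
  finally show ?thesis .
qed

lemma normal_cdf_diff_eq_expectation_step:
  assumes "s > 0"
  shows "normal_cdf s y - normal_cdf s a = (LINT x|std_normal_distribution. cdf_step a y (s * x))"
proof -
  interpret S: prob_space std_normal_distribution
    by (rule prob_space_normal_density) simp
  have "integrable std_normal_distribution (\<lambda>x. indicat_real {..c} (s * x))" for c
    by (rule S.integrable_const_bound[where B=1]) auto
  then show ?thesis
    by (simp add: cdf_step_def normal_cdf_eq_expectation[OF assms])
qed

section \<open>Normal scale mixtures\<close>

text \<open>The parameter s sits inside a density, so measurability is obtained from an integral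
  with parameter instead. The density depends on s only through its absolute value, and the single
  point \<open>s = 0\<close> is treated as a constant.\<close>

lemma normal_cdf_measurable [measurable]: "(\<lambda>s. normal_cdf s c) \<in> borel_measurable borel"
proof -
  interpret S: prob_space std_normal_distribution
    by (rule prob_space_normal_density) simp
  let ?g = "\<lambda>s. if s = 0 then normal_cdf 0 c else LINT x|std_normal_distribution. indicat_real {..c} (\<bar>s\<bar> * x)"
  have "normal_cdf s c = ?g s" for s
  proof (cases "s = 0")
    case False
    have "normal_cdf s c = normal_cdf \<bar>s\<bar> c"
      by (simp add: normal_cdf_def normal_density_def)
    then show ?thesis using False by (simp add: normal_cdf_eq_expectation)
  qed simp
  then have "(\<lambda>s. normal_cdf s c) = ?g" by (rule ext)
  moreover have "?g \<in> borel_measurable borel" by measurable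
  ultimately show ?thesis by simp
qed

text \<open>The limit law is realised as \<open>\<sigma> * V\<close> times a standard normal vector
  living on an additional product factor. This puts the limiting moment in the form to which the
  comparison of characteristic functions applies.\<close>

lemma char_normal_mixture:
  fixes j :: nat
  assumes "prob_space N" and V[measurable]: "V \<in> borel_measurable N"
  shows "(CLINT \<omega>|(N \<Otimes>\<^sub>M (\<Pi>\<^sub>M i\<in>{..<j}. std_normal_distribution)). iexp (\<Sum>i<j. t i * (\<sigma> * V (fst \<omega>) * snd \<omega> i)))
    = complex_of_real (LINT \<omega>|N. exp (- (V \<omega>)\<^sup>2 * (\<sigma>\<^sup>2 * (\<Sum>i<j. (t i)\<^sup>2)) / 2))"
proof -
  interpret N: prob_space N by fact
  interpret S: prob_space std_normal_distribution
    by (rule prob_space_normal_density) simp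
  interpret G: product_sigma_finite "\<lambda>i::nat. std_normal_distribution"
    by standard
  interpret GG: prob_space "\<Pi>\<^sub>M i\<in>{..<j}. std_normal_distribution"
    by (rule prob_space_PiM) (rule S.prob_space_axioms)
  interpret pair_prob_space N "\<Pi>\<^sub>M i\<in>{..<j}. std_normal_distribution" ..
  let ?f = "\<lambda>\<omega>. iexp (\<Sum>i<j. t i * (\<sigma> * V (fst \<omega>) * snd \<omega> i))"
  have "integrable (N \<Otimes>\<^sub>M (\<Pi>\<^sub>M i\<in>{..<j}. std_normal_distribution)) ?f"
    by (rule P.integrable_const_bound[where B=1]) auto
  from integral_fst'[OF this]
  have "integral\<^sup>L (N \<Otimes>\<^sub>M (\<Pi>\<^sub>M i\<in>{..<j}. std_normal_distribution)) ?f
    = (CLINT x|N. CLINT g|(\<Pi>\<^sub>M i\<in>{..<j}. std_normal_distribution). iexp (\<Sum>i<j. t i * (\<sigma> * V x * g i)))"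
    by simp
  also have "\<dots> = (CLINT x|N. complex_of_real (exp (- (V x)\<^sup>2 * (\<sigma>\<^sup>2 * (\<Sum>i<j. (t i)\<^sup>2)) / 2)))"
  proof (rule Bochner_Integration.integral_cong[OF refl])
    fix x
    have "(CLINT g|(\<Pi>\<^sub>M i\<in>{..<j}. std_normal_distribution). iexp (\<Sum>i<j. t i * (\<sigma> * V x * g i)))
      = (CLINT g|(\<Pi>\<^sub>M i\<in>{..<j}. std_normal_distribution). (\<Prod>i<j. iexp ((t i * \<sigma> * V x) * g i)))"
      by (simp add: exp_sum sum_distrib_left mult_ac)
    also have "\<dots> = (\<Prod>i<j. CLINT u|std_normal_distribution. iexp ((t i * \<sigma> * V x) * u))"
      by (rule G.product_integral_prod) (auto intro!: S.integrable_const_bound[where B=1])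
    also have "\<dots> = (\<Prod>i<j. char std_normal_distribution (t i * \<sigma> * V x))"
      unfolding char_def ..
    also have "\<dots> = complex_of_real (exp (\<Sum>i<j. - (t i * \<sigma> * V x)\<^sup>2 / 2))"
      by (simp add: char_std_normal_distribution exp_sum)
    also have "(\<Sum>i<j. - (t i * \<sigma> * V x)\<^sup>2 / 2) = - (V x)\<^sup>2 * (\<sigma>\<^sup>2 * (\<Sum>i<j. (t i)\<^sup>2)) / 2"
      by (simp add: sum_distrib_left sum_divide_distrib sum_negf power_mult_distrib mult_ac)
    finally show "(CLINT g|(\<Pi>\<^sub>M i\<in>{..<j}. std_normal_distribution). iexp (\<Sum>i<j. t i * (\<sigma> * V x * g i)))
      = complex_of_real (exp (- (V x)\<^sup>2 * (\<sigma>\<^sup>2 * (\<Sum>i<j. (t i)\<^sup>2)) / 2))" .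
  qed
  finally show ?thesis by simp
qed

text \<open>Given V the coordinates are independent and identically distributed, so the expectation
  of the product is a j-th power. Almost sure positivity of V enters because
  \<open>normal_cdf\<close> at 0 is not the distribution function of a point mass.\<close>

lemma step_normal_mixture:
  fixes j :: nat
  assumes "prob_space N" and V[measurable]: "V \<in> borel_measurable N"
    and pos: "AE \<omega> in N. 0 < V \<omega>" and "\<sigma> > 0"
  shows "(LINT \<omega>|(N \<Otimes>\<^sub>M (\<Pi>\<^sub>M i\<in>{..<j}. std_normal_distribution)). (\<Prod>i<j. cdf_step a y (\<sigma> * V (fst \<omega>) * snd \<omega> i)))
    = (LINT \<omega>|N. (normal_cdf (\<sigma> * V \<omega>) y - normal_cdf (\<sigma> * V \<omega>) a) ^ j)"
proof -
  interpret N: prob_space N by fact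
  interpret S: prob_space std_normal_distribution
    by (rule prob_space_normal_density) simp
  interpret G: product_sigma_finite "\<lambda>i::nat. std_normal_distribution"
    by standard
  interpret GG: prob_space "\<Pi>\<^sub>M i\<in>{..<j}. std_normal_distribution"
    by (rule prob_space_PiM) (rule S.prob_space_axioms)
  interpret pair_prob_space N "\<Pi>\<^sub>M i\<in>{..<j}. std_normal_distribution" ..
  let ?f = "\<lambda>\<omega>. \<Prod>i<j. cdf_step a y (\<sigma> * V (fst \<omega>) * snd \<omega> i)"
  have "integrable (N \<Otimes>\<^sub>M (\<Pi>\<^sub>M i\<in>{..<j}. std_normal_distribution)) ?f"
    by (rule P.integrable_const_bound[where B=1]) (auto simp: abs_prod abs_step_le intro!: prod_le_1)
  from integral_fst'[OF this]
  have "integral\<^sup>L (N \<Otimes>\<^sub>M (\<Pi>\<^sub>M i\<in>{..<j}. std_normal_distribution)) ?f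
    = (LINT x|N. LINT g|(\<Pi>\<^sub>M i\<in>{..<j}. std_normal_distribution). (\<Prod>i<j. cdf_step a y (\<sigma> * V x * g i)))"
    by simp
  also have "\<dots> = (LINT x|N. (\<Prod>i<j. (LINT u|std_normal_distribution. cdf_step a y (\<sigma> * V x * u))))"
    by (intro Bochner_Integration.integral_cong refl G.product_integral_prod)
      (auto intro!: S.integrable_const_bound[where B=1] simp: abs_step_le)
  also have "\<dots> = (LINT \<omega>|N. (normal_cdf (\<sigma> * V \<omega>) y - normal_cdf (\<sigma> * V \<omega>) a) ^ j)"
  proof (rule integral_cong_AE)
    show "AE x in N. (\<Prod>i<j. (LINT u|std_normal_distribution. cdf_step a y (\<sigma> * V x * u)))
        = (normal_cdf (\<sigma> * V x) y - normal_cdf (\<sigma> * V x) a) ^ j"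
      using pos by eventually_elim (simp add: normal_cdf_diff_eq_expectation_step \<open>\<sigma> > 0\<close>)
  qed measurable
  finally show ?thesis .
qed

text \<open>Here b measures how far the quadratic form Q is from the spherical one. The restriction
  on b keeps both forms above \<open>s\<^sup>2\<close> times the squared norm of t, so for each
  value v of V the exponentials differ by at most b times a Gaussian second-moment integrand.
  Tonelli and an integration over t then leave an inverse moment of V.\<close>

lemma integral_exp_diff_le:
  assumes N: "prob_space N" and V[measurable]: "V \<in> borel_measurable N"
    and pos: "AE \<omega> in N. 0 < V \<omega>" and s: "s > 0" and b: "0 \<le> b" "b \<le> \<sigma>\<^sup>2 - s\<^sup>2"
    and Q[measurable]: "Q \<in> borel_measurable (lborel_vec j)"
    and Q_le: "\<And>t. \<bar>Q t - \<sigma>\<^sup>2 * (\<Sum>i<j. (t i)\<^sup>2)\<bar> \<le> b * (\<Sum>i<j. (t i)\<^sup>2)"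
    and int: "integrable N (\<lambda>\<omega>. inverse (V \<omega>) ^ j)"
  shows "(\<integral>\<^sup>+t. ennreal \<bar>(LINT \<omega>|N. exp (- (V \<omega>)\<^sup>2 * Q t / 2)) - (LINT \<omega>|N. exp (- (V \<omega>)\<^sup>2 * (\<sigma>\<^sup>2 * (\<Sum>i<j. (t i)\<^sup>2)) / 2))\<bar> \<partial>lborel_vec j)
    \<le> ennreal (b / 2 * (real j * (sqrt (2 * pi) / s) ^ j / s\<^sup>2) * (LINT \<omega>|N. inverse (V \<omega>) ^ j))"
proof -
  interpret N: prob_space N by fact
  interpret L: product_sigma_finite "\<lambda>i::nat. lborel :: real measure" by standard
  interpret L: sigma_finite_measure "lborel_vec j" by (rule L.sigma_finite) simp
  interpret pair_sigma_finite N "lborel_vec j" ..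
  let ?T = "\<lambda>t. \<Sum>i<j. (t i)\<^sup>2"
  have T: "0 \<le> ?T t" for t :: "nat \<Rightarrow> real" by (simp add: sum_nonneg)
  have Qlow: "s\<^sup>2 * ?T t \<le> Q t" for t
  proof -
    have "s\<^sup>2 * ?T t \<le> (\<sigma>\<^sup>2 - b) * ?T t" using b by (intro mult_right_mono T) auto
    then show ?thesis using Q_le[of t] by (simp add: left_diff_distrib)
  qed
  have s\<sigma>: "s\<^sup>2 * ?T t \<le> \<sigma>\<^sup>2 * ?T t" for t :: "nat \<Rightarrow> real"
    using b by (intro mult_right_mono T) auto
  let ?E = "\<lambda>v t. \<bar>exp (- v\<^sup>2 * Q t / 2) - exp (- v\<^sup>2 * (\<sigma>\<^sup>2 * ?T t) / 2)\<bar>"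
  have pt: "?E v t \<le> b / 2 * v\<^sup>2 * (?T t * exp (- (v * s)\<^sup>2 * ?T t / 2))" for v t
  proof -
    have "?E v t \<le> \<bar>v\<^sup>2 * Q t / 2 - v\<^sup>2 * (\<sigma>\<^sup>2 * ?T t) / 2\<bar> * exp (- (v\<^sup>2 * (s\<^sup>2 * ?T t) / 2))"
      using abs_exp_minus_diff_le[of "v\<^sup>2 * (s\<^sup>2 * ?T t) / 2" "v\<^sup>2 * Q t / 2" "v\<^sup>2 * (\<sigma>\<^sup>2 * ?T t) / 2"]
      using Qlow[of t] s\<sigma>[of t] by (simp add: mult_left_mono)
    also have "v\<^sup>2 * Q t / 2 - v\<^sup>2 * (\<sigma>\<^sup>2 * ?T t) / 2 = v\<^sup>2 / 2 * (Q t - \<sigma>\<^sup>2 * ?T t)"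
      by (simp add: field_simps)
    also have "\<bar>\<dots>\<bar> = v\<^sup>2 / 2 * \<bar>Q t - \<sigma>\<^sup>2 * ?T t\<bar>" by (simp add: abs_mult)
    also have "\<dots> * exp (- (v\<^sup>2 * (s\<^sup>2 * ?T t) / 2)) \<le> v\<^sup>2 / 2 * (b * ?T t) * exp (- (v\<^sup>2 * (s\<^sup>2 * ?T t) / 2))"
      by (intro mult_right_mono mult_left_mono Q_le) auto
    finally show ?thesis by (simp add: power_mult_distrib mult_ac)
  qed
  have i1: "integrable N (\<lambda>\<omega>. exp (- (V \<omega>)\<^sup>2 * q / 2))" if "0 \<le> q" for q
    using that by (intro N.integrable_const_bound[where B=1]) auto
  have "(\<integral>\<^sup>+t. ennreal \<bar>(LINT \<omega>|N. exp (- (V \<omega>)\<^sup>2 * Q t / 2)) - (LINT \<omega>|N. exp (- (V \<omega>)\<^sup>2 * (\<sigma>\<^sup>2 * ?T t) / 2))\<bar> \<partial>lborel_vec j)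
    \<le> (\<integral>\<^sup>+t. \<integral>\<^sup>+\<omega>. ennreal (?E (V \<omega>) t) \<partial>N \<partial>lborel_vec j)"
  proof (rule nn_integral_mono)
    fix t
    have q: "0 \<le> Q t" "0 \<le> \<sigma>\<^sup>2 * ?T t"
      using Qlow[of t] T[of t] by (auto intro: order_trans[rotated])
    have "ennreal \<bar>(LINT \<omega>|N. exp (- (V \<omega>)\<^sup>2 * Q t / 2)) - (LINT \<omega>|N. exp (- (V \<omega>)\<^sup>2 * (\<sigma>\<^sup>2 * ?T t) / 2))\<bar>
      = ennreal (norm (LINT \<omega>|N. exp (- (V \<omega>)\<^sup>2 * Q t / 2) - exp (- (V \<omega>)\<^sup>2 * (\<sigma>\<^sup>2 * ?T t) / 2)))"
      unfolding real_norm_def by (subst Bochner_Integration.integral_diff[OF i1[OF q(1)] i1[OF q(2)]]) (rule refl)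
    also have "\<dots> \<le> (\<integral>\<^sup>+\<omega>. ennreal (norm (exp (- (V \<omega>)\<^sup>2 * Q t / 2) - exp (- (V \<omega>)\<^sup>2 * (\<sigma>\<^sup>2 * ?T t) / 2))) \<partial>N)"
      by (intro integral_norm_bound_ennreal Bochner_Integration.integrable_diff i1 q)
    finally show "ennreal \<bar>(LINT \<omega>|N. exp (- (V \<omega>)\<^sup>2 * Q t / 2)) - (LINT \<omega>|N. exp (- (V \<omega>)\<^sup>2 * (\<sigma>\<^sup>2 * ?T t) / 2))\<bar>
      \<le> (\<integral>\<^sup>+\<omega>. ennreal (?E (V \<omega>) t) \<partial>N)" by simp
  qed
  also have "\<dots> = (\<integral>\<^sup>+\<omega>. \<integral>\<^sup>+t. ennreal (?E (V \<omega>) t) \<partial>lborel_vec j \<partial>N)"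
    by (rule Fubini') measurable
  also have "\<dots> \<le> (\<integral>\<^sup>+\<omega>. ennreal (b / 2 * (real j * (sqrt (2 * pi) / s) ^ j / s\<^sup>2) * inverse (V \<omega>) ^ j) \<partial>N)"
  proof (rule nn_integral_mono_AE, use pos in eventually_elim)
    fix \<omega> assume v: "0 < V \<omega>"
    have "(\<integral>\<^sup>+t. ennreal (?E (V \<omega>) t) \<partial>lborel_vec j)
      \<le> (\<integral>\<^sup>+t. ennreal (b / 2 * (V \<omega>)\<^sup>2) * ennreal (?T t * exp (- (V \<omega> * s)\<^sup>2 * ?T t / 2)) \<partial>lborel_vec j)"
      using b pt[of "V \<omega>"] T by (intro nn_integral_mono) (auto simp: ennreal_mult[symmetric] intro!: ennreal_leI)
    also have "\<dots> = ennreal (b / 2 * (V \<omega>)\<^sup>2) * ennreal (real j * (sqrt (2 * pi) / (V \<omega> * s)) ^ j / (V \<omega> * s)\<^sup>2)"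
      by (subst nn_integral_cmult, measurable) (simp only: nn_integral_sq_norm_gauss mult_pos_pos v s)
    also have "\<dots> = ennreal (b / 2 * (V \<omega>)\<^sup>2 * (real j * (sqrt (2 * pi) / (V \<omega> * s)) ^ j / (V \<omega> * s)\<^sup>2))"
      using v s b by (intro ennreal_mult[symmetric]) auto
    \<comment> \<open>The Gaussian integral contributes \<open>j + 2\<close> inverse powers of
      \<open>V \<omega>\<close>; two of them cancel against \<open>(V \<omega>)\<^sup>2\<close>,
      which is why exactly the moment of order \<open>- j\<close> appears.\<close>
    also have "b / 2 * (V \<omega>)\<^sup>2 * (real j * (sqrt (2 * pi) / (V \<omega> * s)) ^ j / (V \<omega> * s)\<^sup>2)
      = b / 2 * (real j * (sqrt (2 * pi) / s) ^ j / s\<^sup>2) * inverse (V \<omega>) ^ j"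
      using v s by (simp add: power_mult_distrib power_divide power_inverse field_simps)
    finally show "(\<integral>\<^sup>+t. ennreal (?E (V \<omega>) t) \<partial>lborel_vec j)
      \<le> ennreal (b / 2 * (real j * (sqrt (2 * pi) / s) ^ j / s\<^sup>2) * inverse (V \<omega>) ^ j)" .
  qed
  also have "\<dots> = ennreal (LINT \<omega>|N. b / 2 * (real j * (sqrt (2 * pi) / s) ^ j / s\<^sup>2) * inverse (V \<omega>) ^ j)"
    using pos b s by (intro nn_integral_eq_integral integrable_mult_right int) (auto elim!: eventually_mono)
  finally show ?thesis by simp
qed

text \<open>This joins the Fourier comparison with the estimate for the difference of Gaussian
  mixtures. It is meant for the situation where the copies of X are frozen and Q is the form of
  their Gram matrix.\<close>

lemma step_expectation_normal_mixture_bound: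
  assumes M: "prob_space M" and Z: "\<And>i. i < j \<Longrightarrow> Z i \<in> borel_measurable M"
    and N: "prob_space N" and V: "V \<in> borel_measurable N"
    and pos: "AE \<omega> in N. 0 < V \<omega>" and int: "integrable N (\<lambda>\<omega>. inverse (V \<omega>) ^ j)"
    and "\<sigma> > 0" and s: "s > 0" and b: "0 \<le> b" "b \<le> \<sigma>\<^sup>2 - s\<^sup>2"
    and Q: "Q \<in> borel_measurable (lborel_vec j)"
    and Q_le: "\<And>t. \<bar>Q t - \<sigma>\<^sup>2 * (\<Sum>i<j. (t i)\<^sup>2)\<bar> \<le> b * (\<Sum>i<j. (t i)\<^sup>2)"
    and char: "\<And>t. (CLINT \<omega>|M. iexp (\<Sum>i<j. t i * Z i \<omega>)) = complex_of_real (LINT \<omega>|N. exp (- (V \<omega>)\<^sup>2 * Q t / 2))"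
  shows "\<bar>(LINT \<omega>|M. (\<Prod>i<j. cdf_step a y (Z i \<omega>))) - (LINT \<omega>|N. (normal_cdf (\<sigma> * V \<omega>) y - normal_cdf (\<sigma> * V \<omega>) a) ^ j)\<bar>
    \<le> (\<bar>y - a\<bar> / (2 * pi)) ^ j * (b / 2 * (real j * (sqrt (2 * pi) / s) ^ j / s\<^sup>2) * (LINT \<omega>|N. inverse (V \<omega>) ^ j))"
    (is "?L \<le> ?c * ?R")
proof -
  have "0 \<le> (LINT \<omega>|N. inverse (V \<omega>) ^ j)"
    using pos by (intro integral_nonneg_AE) (auto elim!: eventually_mono)
  then have R: "0 \<le> ?R"
    using b s by (intro mult_nonneg_nonneg) auto
  let ?P' = "N \<Otimes>\<^sub>M (\<Pi>\<^sub>M i\<in>{..<j}. std_normal_distribution)"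
  have S: "prob_space std_normal_distribution"
    by (rule prob_space_normal_density) simp
  have P': "prob_space ?P'"
    by (intro prob_space_pair prob_space_PiM N S)
  have Z': "(\<lambda>\<omega>. \<sigma> * V (fst \<omega>) * snd \<omega> i) \<in> borel_measurable ?P'" if "i < j" for i
    using V by measurable (use that in auto)
  have "ennreal ?L \<le> ennreal ?c * (\<integral>\<^sup>+t. ennreal (norm ((CLINT \<omega>|M. iexp (\<Sum>i<j. t i * Z i \<omega>))
          - (CLINT \<omega>|?P'. iexp (\<Sum>i<j. t i * (\<sigma> * V (fst \<omega>) * snd \<omega> i))))) \<partial>lborel_vec j)"
    unfolding step_normal_mixture[OF N V pos \<open>\<sigma> > 0\<close>, symmetric]
    by (rule step_expectation_diff_le_char_diff) (fact M, erule Z, fact P', erule Z')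
  also have "\<dots> \<le> ennreal ?c * ennreal ?R"
    unfolding char char_normal_mixture[OF N V] of_real_diff[symmetric] norm_of_real
    by (intro mult_left_mono integral_exp_diff_le N V pos s b Q Q_le int) auto
  also have "\<dots> = ennreal (?c * ?R)"
    using R by (intro ennreal_mult''[symmetric])
  finally show ?thesis
    by (simp only: ennreal_le_iff[OF mult_nonneg_nonneg[OF _ R]] zero_le_power divide_nonneg_nonneg abs_ge_zero pi_ge_zero mult_nonneg_nonneg zero_le_numeral)
qed

section \<open>Conditional distribution functions and the Gram form\<close>

lemma dot_measurable [measurable (raw)]:
  assumes [measurable]: "f \<in> measurable K (borel_vec d)" "g \<in> measurable K (borel_vec d)"
  shows "(\<lambda>x. dot d (f x) (g x)) \<in> borel_measurable K"
  unfolding dot_def by measurable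

text \<open>Independence makes the joint law a product, and Fubini applies. Both marginal integrals
  are pulled back to M, so \<open>A \<omega>'\<close> acts as a copy of A independent of
  \<open>B \<omega>\<close>.\<close>

lemma (in prob_space) expectation_indep_var_eq_iterated:
  fixes f :: "'b \<Rightarrow> 'b \<Rightarrow> real"
  assumes ind: "indep_var S A T B"
    and f[measurable]: "case_prod f \<in> borel_measurable (S \<Otimes>\<^sub>M T)"
    and bnd: "\<And>x y. \<bar>f x y\<bar> \<le> c"
  shows "(LINT \<omega>|M. f (A \<omega>) (B \<omega>)) = (LINT \<omega>|M. LINT \<omega>'|M. f (A \<omega>') (B \<omega>))"
proof -
  have [measurable]: "A \<in> measurable M S" "B \<in> measurable M T"
    and D: "distr M S A \<Otimes>\<^sub>M distr M T B = distr M (S \<Otimes>\<^sub>M T) (\<lambda>\<omega>. (A \<omega>, B \<omega>))"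
    using ind by (auto simp: indep_var_distribution_eq)
  interpret A: prob_space "distr M S A" by (rule prob_space_distr) simp
  interpret B: prob_space "distr M T B" by (rule prob_space_distr) simp
  interpret AB: pair_prob_space "distr M S A" "distr M T B" ..
  have int: "integrable (distr M S A \<Otimes>\<^sub>M distr M T B) (case_prod f)"
    by (rule AB.P.integrable_const_bound[where B=c]) (auto simp: bnd)
  have "(LINT \<omega>|M. f (A \<omega>) (B \<omega>)) = (LINT p|distr M (S \<Otimes>\<^sub>M T) (\<lambda>\<omega>. (A \<omega>, B \<omega>)). case_prod f p)"
    by (subst integral_distr) auto
  also have "\<dots> = (LINT y|distr M T B. LINT x|distr M S A. f x y)"
    unfolding D[symmetric] AB.integral_snd[OF int, symmetric] ..
  also have "\<dots> = (LINT \<omega>|M. LINT x|distr M S A. f x (B \<omega>))"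
    by (rule integral_distr) measurable
  also have "\<dots> = (LINT \<omega>|M. LINT \<omega>'|M. f (A \<omega>') (B \<omega>))"
    by (intro Bochner_Integration.integral_cong refl integral_distr)
      (auto intro!: measurable_compose[OF _ f] measurable_Pair2' dest: measurable_space[OF \<open>B \<in> measurable M T\<close>])
  finally show ?thesis .
qed

lemma (in prob_space) cond_cdf_dot_eq:
  assumes ind: "indep_var (borel_vec d) X (borel_vec d) \<Xi>"
  shows "AE \<omega> in M. cond_cdf M d \<Xi> (\<lambda>\<omega>. dot d (\<Xi> \<omega>) (X \<omega>)) y \<omega>
    = (LINT \<omega>'|M. indicat_real {..y} (dot d (\<Xi> \<omega>) (X \<omega>')))"
proof -
  let ?F = "vimage_algebra (space M) \<Xi> (borel_vec d)"
  let ?h = "\<lambda>\<xi>. LINT \<omega>'|M. indicat_real {..y} (dot d \<xi> (X \<omega>'))"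
  have [measurable]: "X \<in> measurable M (borel_vec d)" and \<Xi>[measurable]: "\<Xi> \<in> measurable M (borel_vec d)"
    using ind by (auto simp: indep_var_distribution_eq)
  have sub: "subalgebra M ?F"
    unfolding subalgebra_def
    using measurable_sets[OF \<Xi>] by (auto simp: sets_vimage_algebra2[OF measurable_space[OF \<Xi>, THEN funcsetI]])
  interpret finite_measure_subalgebra M ?F
    by unfold_locales (rule sub)
  have h[measurable]: "?h \<in> borel_measurable (borel_vec d)"
    by measurable
  have \<Xi>F: "\<Xi> \<in> measurable ?F (borel_vec d)"
    by (rule measurable_vimage_algebra1) (use measurable_space[OF \<Xi>] in auto)
  have h01: "\<bar>?h (\<Xi> \<omega>)\<bar> \<le> 1" if "\<omega> \<in> space M" for \<omega>
  proof -
    have "integrable M (\<lambda>\<omega>'. indicat_real {..y} (dot d (\<Xi> \<omega>) (X \<omega>')))"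
      using that by (intro integrable_const_bound[where B=1]) auto
    then show ?thesis
      using integral_le_const[of _ 1] integral_ge_const[of _ 0] by (auto simp: abs_le_iff intro: order_trans[of _ 0])
  qed
  show ?thesis unfolding cond_cdf_def
  proof (rule real_cond_exp_charact)
    fix A assume "A \<in> sets ?F"
    then obtain B where B[measurable]: "B \<in> sets (borel_vec d)" and A: "A = \<Xi> -` B \<inter> space M"
      by (auto simp: sets_vimage_algebra2[OF measurable_space[OF \<Xi>, THEN funcsetI]])
    have "(LINT \<omega>:A|M. indicat_real {\<omega> \<in> space M. dot d (\<Xi> \<omega>) (X \<omega>) \<le> y} \<omega>)
      = (LINT \<omega>|M. indicat_real B (\<Xi> \<omega>) * indicat_real {..y} (dot d (\<Xi> \<omega>) (X \<omega>)))"
      unfolding set_lebesgue_integral_def A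
      by (intro Bochner_Integration.integral_cong refl) (auto simp: indicator_def)
    also have "\<dots> = (LINT \<omega>|M. LINT \<omega>'|M. indicat_real B (\<Xi> \<omega>) * indicat_real {..y} (dot d (\<Xi> \<omega>) (X \<omega>')))"
      by (rule expectation_indep_var_eq_iterated[OF ind, where c=1 and f="\<lambda>x \<xi>. indicat_real B \<xi> * indicat_real {..y} (dot d \<xi> x)"]) (auto simp: indicator_def)
    also have "\<dots> = (LINT \<omega>:A|M. ?h (\<Xi> \<omega>))"
      unfolding set_lebesgue_integral_def A
      by (intro Bochner_Integration.integral_cong refl) (auto simp: indicator_def)
    finally show "(LINT \<omega>:A|M. indicat_real {\<omega> \<in> space M. dot d (\<Xi> \<omega>) (X \<omega>) \<le> y} \<omega>) = (LINT \<omega>:A|M. ?h (\<Xi> \<omega>))" .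
  next
    show "integrable M (indicat_real {\<omega> \<in> space M. dot d (\<Xi> \<omega>) (X \<omega>) \<le> y})"
      by (rule integrable_const_bound[where B=1]) auto
    have "AE \<omega> in M. norm (?h (\<Xi> \<omega>)) \<le> 1"
      using h01 by (intro AE_I2) (simp only: real_norm_def)
    then show "integrable M (\<lambda>\<omega>. ?h (\<Xi> \<omega>))"
      by (rule integrable_const_bound) measurable
    show "(\<lambda>\<omega>. ?h (\<Xi> \<omega>)) \<in> borel_measurable ?F"
      by (rule measurable_compose[OF \<Xi>F h])
  qed
qed

text \<open>The j-th power of an integral over X is one integral over j independent copies. Fubini
  then puts the copies outside and \<open>\<Xi>\<close> inside, so that with the copies fixed the
  characteristic function of \<open>\<Xi>\<close> can be used.\<close>

lemma (in prob_space) expectation_cond_cdf_diff_power: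
  fixes j :: nat
  assumes ind: "indep_var (borel_vec d) X (borel_vec d) \<Xi>"
  defines "Y \<equiv> \<lambda>\<omega>. dot d (\<Xi> \<omega>) (X \<omega>)"
  shows "(LINT \<omega>|M. (cond_cdf M d \<Xi> Y y \<omega> - cond_cdf M d \<Xi> Y a \<omega>) ^ j)
    = (LINT \<omega>|copies_space M j. LINT \<omega>'|M. (\<Prod>i<j. cdf_step a y (dot d (\<Xi> \<omega>') (X (\<omega> i)))))"
proof -
  have [measurable]: "X \<in> measurable M (borel_vec d)" "\<Xi> \<in> measurable M (borel_vec d)"
    using ind by (auto simp: indep_var_distribution_eq)
  interpret C: product_sigma_finite "\<lambda>i::nat. M" ..
  interpret CC: prob_space "copies_space M j"
    by (rule prob_space_PiM) (rule prob_space_axioms)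
  interpret CM: pair_prob_space "copies_space M j" M ..
  have int: "integrable M (\<lambda>\<omega>'. indicat_real {..c} (dot d (\<Xi> \<omega>) (X \<omega>')))" if "\<omega> \<in> space M" for c \<omega>
    using that by (intro integrable_const_bound[where B=1]) auto
  have "(LINT \<omega>|M. (cond_cdf M d \<Xi> Y y \<omega> - cond_cdf M d \<Xi> Y a \<omega>) ^ j)
    = (LINT \<omega>'|M. (LINT \<omega>|M. cdf_step a y (dot d (\<Xi> \<omega>') (X \<omega>))) ^ j)"
  proof (rule integral_cong_AE)
    show "AE \<omega> in M. (cond_cdf M d \<Xi> Y y \<omega> - cond_cdf M d \<Xi> Y a \<omega>) ^ j
      = (LINT \<omega>'|M. cdf_step a y (dot d (\<Xi> \<omega>) (X \<omega>'))) ^ j"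
      using cond_cdf_dot_eq[OF ind, of y] cond_cdf_dot_eq[OF ind, of a] AE_space
      by eventually_elim (simp add: cdf_step_def Y_def int)
  qed (simp_all add: cond_cdf_def)
  also have "\<dots> = (LINT \<omega>'|M. LINT \<omega>|copies_space M j. (\<Prod>i<j. cdf_step a y (dot d (\<Xi> \<omega>') (X (\<omega> i)))))"
  proof (rule Bochner_Integration.integral_cong[OF refl])
    fix \<omega>' assume "\<omega>' \<in> space M"
    then have "integrable M (\<lambda>\<omega>. cdf_step a y (dot d (\<Xi> \<omega>') (X \<omega>)))"
      by (intro integrable_const_bound[where B=1]) (auto simp: abs_step_le)
    then show "(LINT \<omega>|M. cdf_step a y (dot d (\<Xi> \<omega>') (X \<omega>))) ^ j
      = (LINT \<omega>|copies_space M j. (\<Prod>i<j. cdf_step a y (dot d (\<Xi> \<omega>') (X (\<omega> i)))))"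
      by (subst C.product_integral_prod) auto
  qed
  also have "\<dots> = (LINT \<omega>|copies_space M j. LINT \<omega>'|M. (\<Prod>i<j. cdf_step a y (dot d (\<Xi> \<omega>') (X (\<omega> i)))))"
    by (rule CM.Fubini_integral, rule CM.P.integrable_const_bound[where B=1])
      (auto simp: abs_prod abs_step_le split: prod.split intro!: AE_I2 prod_le_1)
  finally show ?thesis .
qed

lemma frobenius_norm_gram_diff:
  "frobenius_norm (gram_matrix d X j \<omega> - c \<cdot>\<^sub>m 1\<^sub>m j)
    = sqrt (\<Sum>i<j. \<Sum>r<j. (dot d (X (\<omega> i)) (X (\<omega> r)) - (if i = r then c else 0))\<^sup>2)"
proof -
  have "(gram_matrix d X j \<omega> - c \<cdot>\<^sub>m 1\<^sub>m j) $$ (i, r) = dot d (X (\<omega> i)) (X (\<omega> r)) - (if i = r then c else 0)"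
    if "i < j" "r < j" for i r
    using that by (simp add: gram_matrix_def)
  then show ?thesis
    unfolding frobenius_norm_def by (simp add: scalar_prod_def power2_eq_square lessThan_atLeast0 gram_matrix_def)
qed

text \<open>This is the quadratic form of the Gram matrix of the vectors \<open>x i\<close>. Written
  as a squared norm it is the argument at which \<open>\<psi>\<close> is evaluated, and the
  restriction to \<open>{..<d}\<close> places the linear combination in the carrier of
  \<open>borel_vec d\<close>.\<close>

definition gram_form :: "nat \<Rightarrow> nat \<Rightarrow> (nat \<Rightarrow> nat \<Rightarrow> real) \<Rightarrow> (nat \<Rightarrow> real) \<Rightarrow> real" where
  "gram_form d j x t = (vnorm d (\<lambda>l\<in>{..<d}. \<Sum>i<j. t i * x i l))\<^sup>2"

lemma gram_form_eq: "gram_form d j x t = (\<Sum>i<j. \<Sum>r<j. t i * t r * dot d (x i) (x r))"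
proof -
  have "gram_form d j x t = (\<Sum>l<d. (\<Sum>i<j. t i * x i l)\<^sup>2)"
    by (simp add: gram_form_def L2_set_def sum_nonneg)
  also have "\<dots> = (\<Sum>l<d. \<Sum>i<j. \<Sum>r<j. t i * t r * (x i l * x r l))"
    by (simp add: power2_eq_square sum_product mult_ac)
  also have "\<dots> = (\<Sum>i<j. \<Sum>r<j. \<Sum>l<d. t i * t r * (x i l * x r l))"
    by (subst sum.swap) (intro sum.cong refl sum.swap)
  finally show ?thesis
    by (simp add: dot_def sum_distrib_left)
qed

text \<open>Cauchy-Schwarz over the index pairs: the entries of the matrix difference are paired
  with the numbers \<open>t i * t r\<close>, whose Euclidean norm is the sum of the
  \<open>(t i)\<^sup>2\<close>.\<close>

lemma gram_form_diff_le:
  "\<bar>gram_form d j (\<lambda>i. X (\<omega> i)) t - c * (\<Sum>i<j. (t i)\<^sup>2)\<bar>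
    \<le> frobenius_norm (gram_matrix d X j \<omega> - c \<cdot>\<^sub>m 1\<^sub>m j) * (\<Sum>i<j. (t i)\<^sup>2)"
proof -
  let ?B = "\<lambda>(i, r). dot d (X (\<omega> i)) (X (\<omega> r)) - (if i = r then c else 0)"
  let ?I = "{..<j} \<times> {..<j}"
  have "gram_form d j (\<lambda>i. X (\<omega> i)) t - c * (\<Sum>i<j. (t i)\<^sup>2)
    = (\<Sum>i<j. \<Sum>r<j. ?B (i, r) * (t i * t r))"
  proof -
    have "(\<Sum>r<j. ?B (i, r) * (t i * t r)) = (\<Sum>r<j. t i * t r * dot d (X (\<omega> i)) (X (\<omega> r))) - c * (t i)\<^sup>2"
      if "i < j" for i
    proof -
      have "?B (i, r) * (t i * t r) = t i * t r * dot d (X (\<omega> i)) (X (\<omega> r)) - (if i = r then c * (t i)\<^sup>2 else 0)" for r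
        by (simp add: algebra_simps power2_eq_square)
      then show ?thesis using that by (simp only: sum_subtractf) simp
    qed
    then show ?thesis by (simp add: gram_form_eq sum_subtractf sum_distrib_left)
  qed
  also have "\<dots> = (\<Sum>p\<in>?I. ?B p * (t (fst p) * t (snd p)))"
    by (simp add: sum.cartesian_product split_def)
  finally have "\<bar>gram_form d j (\<lambda>i. X (\<omega> i)) t - c * (\<Sum>i<j. (t i)\<^sup>2)\<bar>
    \<le> (\<Sum>p\<in>?I. \<bar>?B p\<bar> * \<bar>t (fst p) * t (snd p)\<bar>)"
    by (simp only: abs_mult[symmetric] sum_abs)
  also have "\<dots> \<le> L2_set ?B ?I * L2_set (\<lambda>p. t (fst p) * t (snd p)) ?I"
    by (rule L2_set_mult_ineq)
  also have "L2_set ?B ?I = frobenius_norm (gram_matrix d X j \<omega> - c \<cdot>\<^sub>m 1\<^sub>m j)"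
    by (simp add: frobenius_norm_gram_diff L2_set_def sum.cartesian_product split_def)
  also have "L2_set (\<lambda>p. t (fst p) * t (snd p)) ?I = sqrt ((\<Sum>i<j. (t i)\<^sup>2) * (\<Sum>r<j. (t r)\<^sup>2))"
    by (simp add: L2_set_def sum_product sum.cartesian_product split_def power_mult_distrib)
  also have "\<dots> = (\<Sum>i<j. (t i)\<^sup>2)"
    by (simp add: sum_nonneg)
  finally show ?thesis .
qed

lemma gram_form_measurable [measurable]: "gram_form d j x \<in> borel_measurable (lborel_vec j)"
  unfolding gram_form_eq[abs_def] by measurable

lemma char_linear_combination_dot:
  "(CLINT \<omega>|M. iexp (\<Sum>i<j. t i * dot d (\<Xi> \<omega>) (x i))) = char_vec M d \<Xi> (\<lambda>l\<in>{..<d}. \<Sum>i<j. t i * x i l)"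
proof -
  have "(\<Sum>i<j. t i * dot d \<xi> (x i)) = dot d (\<lambda>l\<in>{..<d}. \<Sum>i<j. t i * x i l) \<xi>" for \<xi>
  proof -
    have "(\<Sum>i<j. t i * dot d \<xi> (x i)) = (\<Sum>i<j. \<Sum>l<d. t i * x i l * \<xi> l)"
      by (simp add: dot_def sum_distrib_left mult_ac)
    also have "\<dots> = (\<Sum>l<d. \<Sum>i<j. t i * x i l * \<xi> l)" by (rule sum.swap)
    finally show ?thesis by (simp add: dot_def sum_distrib_right)
  qed
  then show ?thesis by (simp add: char_vec_def)
qed

section \<open>Negative moments and concentration of the Gram matrix\<close>

text \<open>Both measures have the same distribution function. This turns the hypotheses on G into
  statements about the law of V.\<close>

lemma interval_measure_cdf_distr:
  assumes "prob_space N" "V \<in> borel_measurable N"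
  shows "interval_measure (cdf (distr N borel V)) = distr N borel V"
proof -
  interpret N: prob_space N by fact
  interpret real_distribution "distr N borel V"
    by (rule N.real_distribution_distr) fact
  show ?thesis
    by (intro cdf_unique real_distribution_interval_measure real_distribution_axioms cdf_interval_measure)
      (auto intro: cdf_nondecreasing cdf_is_right_cont cdf_lim_at_bot cdf_lim_at_top_prob)
qed

text \<open>The left limit of the distribution function at 0 is the mass of the negative
  half-line.\<close>

lemma AE_nonneg_of_cdf:
  assumes "prob_space N" and V[measurable]: "V \<in> borel_measurable N"
    and G: "\<And>v. v < 0 \<Longrightarrow> cdf (distr N borel V) v = 0"
  shows "AE \<omega> in N. 0 \<le> V \<omega>"
proof -
  interpret N: prob_space N by fact
  interpret real_distribution "distr N borel V"
    by (rule N.real_distribution_distr) fact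
  have "eventually (\<lambda>v. cdf (distr N borel V) v = 0) (at_left 0)"
    using G by (auto simp: eventually_at_filter)
  then have "(cdf (distr N borel V) \<longlongrightarrow> 0) (at_left 0)"
    by (rule tendsto_eventually)
  then have "measure (distr N borel V) {..<0} = 0"
    using cdf_at_left[of 0] tendsto_unique[OF trivial_limit_at_left_real] by blast
  then have "AE v in distr N borel V. v \<notin> {..<0}"
    by (intro AE_not_in) (auto simp: null_sets_def emeasure_eq_measure)
  then show ?thesis
    by (subst (asm) AE_distr_iff) (auto simp: not_less)
qed

text \<open>In \<open>ennreal\<close> the inverse of 0 is infinite, so a finite moment of order
  \<open>- m\<close> excludes an atom at 0. The condition \<open>m \<ge> 1\<close> matters because
  the zeroth power would be 1.\<close>

lemma AE_pos_of_negative_moment: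
  assumes V[measurable]: "V \<in> borel_measurable N"
    and nonneg: "AE \<omega> in N. 0 \<le> V \<omega>" and "m \<ge> 1"
    and mom: "(\<integral>\<^sup>+v\<in>{0..}. inverse (ennreal v) ^ m \<partial>distr N borel V) < \<infinity>"
  shows "AE \<omega> in N. 0 < V \<omega>"
proof -
  have "(\<integral>\<^sup>+\<omega>. inverse (ennreal (V \<omega>)) ^ m * indicator {0..} (V \<omega>) \<partial>N) \<noteq> \<infinity>"
    using mom by (subst (asm) nn_integral_distr) auto
  then have "AE \<omega> in N. inverse (ennreal (V \<omega>)) ^ m * indicator {0..} (V \<omega>) \<noteq> \<infinity>"
    by (rule nn_integral_noteq_infinite[rotated]) measurable
  with nonneg show ?thesis
  proof eventually_elim
    fix \<omega> assume "inverse (ennreal (V \<omega>)) ^ m * indicator {0..} (V \<omega>) \<noteq> \<infinity>" "0 \<le> V \<omega>"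
    then show "0 < V \<omega>"
      using \<open>m \<ge> 1\<close> by (cases "V \<omega> = 0") (auto simp: top_power_ennreal)
  qed
qed

text \<open>Moments are assumed only at the orders given by the dimensions. A lower order j is
  reached by \<open>inverse v ^ j \<le> 1 + inverse v ^ m\<close>, separating
  \<open>v \<ge> 1\<close> from \<open>v < 1\<close>.\<close>

lemma integrable_inverse_power:
  assumes "prob_space N" and V[measurable]: "V \<in> borel_measurable N"
    and pos: "AE \<omega> in N. 0 < V \<omega>" and "j \<le> m"
    and mom: "(\<integral>\<^sup>+v\<in>{0..}. inverse (ennreal v) ^ m \<partial>distr N borel V) < \<infinity>"
  shows "integrable N (\<lambda>\<omega>. inverse (V \<omega>) ^ j)"
proof (rule integrableI_bounded)
  interpret N: prob_space N by fact
  have "(\<integral>\<^sup>+\<omega>. ennreal (norm (inverse (V \<omega>) ^ j)) \<partial>N)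
    \<le> (\<integral>\<^sup>+\<omega>. 1 + inverse (ennreal (V \<omega>)) ^ m * indicator {0..} (V \<omega>) \<partial>N)"
  proof (rule nn_integral_mono_AE, use pos in eventually_elim)
    fix \<omega> assume v: "0 < V \<omega>"
    have "inverse (V \<omega>) ^ j \<le> 1 + inverse (V \<omega>) ^ m"
    proof (cases "inverse (V \<omega>) \<le> 1")
      case True
      then have "inverse (V \<omega>) ^ j \<le> 1" using v by (intro power_le_one) auto
      moreover have "0 \<le> inverse (V \<omega>) ^ m" using v by simp
      ultimately show ?thesis by linarith
    next
      case False
      then have "inverse (V \<omega>) ^ j \<le> inverse (V \<omega>) ^ m"
        using \<open>j \<le> m\<close> by (intro power_increasing) auto
      then show ?thesis by simp
    qed
    then have "ennreal (inverse (V \<omega>) ^ j) \<le> ennreal (1 + inverse (V \<omega>) ^ m)"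
      by (rule ennreal_leI)
    also have "\<dots> = 1 + inverse (ennreal (V \<omega>)) ^ m"
      using v by (simp add: inverse_ennreal ennreal_power)
    finally show "ennreal (norm (inverse (V \<omega>) ^ j)) \<le> 1 + inverse (ennreal (V \<omega>)) ^ m * indicator {0..} (V \<omega>)"
      using v by simp
  qed
  also have "\<dots> = 1 + (\<integral>\<^sup>+\<omega>. inverse (ennreal (V \<omega>)) ^ m * indicator {0..} (V \<omega>) \<partial>N)"
    by (subst nn_integral_add) (auto simp: N.emeasure_space_1)
  also have "\<dots> < \<infinity>"
    using mom by (subst (asm) nn_integral_distr) (auto simp: ennreal_add_less_top)
  finally show "(\<integral>\<^sup>+\<omega>. ennreal (norm (inverse (V \<omega>) ^ j)) \<partial>N) < \<infinity>" .
qed measurable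

text \<open>Where \<open>F x \<le> \<delta>\<close> the linear bound is combined with
  \<open>E F \<le> sqrt (E F\<^sup>2)\<close>. Elsewhere only the bound 2 is available, but
  Chebyshev expresses the probability of that event through the same second moment, with a
  coefficient that vanishes with the probability.\<close>

lemma (in prob_space) truncation_bound:
  assumes [measurable]: "D \<in> borel_measurable M" "F \<in> borel_measurable M"
    and F0: "\<And>x. 0 \<le> F x" and int: "integrable M (\<lambda>x. (F x)\<^sup>2)"
    and D2: "\<And>x. x \<in> space M \<Longrightarrow> \<bar>D x\<bar> \<le> 2"
    and DL: "\<And>x. x \<in> space M \<Longrightarrow> F x \<le> \<delta> \<Longrightarrow> \<bar>D x\<bar> \<le> L * F x"
    and "\<delta> > 0" "L \<ge> 0"
  shows "\<bar>expectation D\<bar> \<le> (L + 2 * sqrt (prob {x\<in>space M. F x > \<delta>}) / \<delta>) * sqrt (expectation (\<lambda>x. (F x)\<^sup>2))"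
proof -
  let ?E = "expectation (\<lambda>x. (F x)\<^sup>2)" and ?p = "prob {x\<in>space M. F x > \<delta>}"
  have intF: "integrable M F"
    by (rule square_integrable_imp_integrable) (use int in auto)
  have "0 \<le> variance F" by (rule variance_positive)
  then have "(expectation F)\<^sup>2 \<le> ?E" by (simp add: variance_eq intF int)
  then have EF: "expectation F \<le> sqrt ?E" by (rule real_le_rsqrt)
  have "prob {x\<in>space M. \<delta>\<^sup>2 \<le> (F x)\<^sup>2} \<le> ?E / \<delta>\<^sup>2"
    using \<open>\<delta> > 0\<close> int by (intro integral_Markov_inequality_measure[where A="{}"]) auto
  moreover have "?p \<le> prob {x\<in>space M. \<delta>\<^sup>2 \<le> (F x)\<^sup>2}"
    using \<open>\<delta> > 0\<close> by (intro finite_measure_mono) (auto intro!: power_mono)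
  ultimately have "?p \<le> ?E / \<delta>\<^sup>2" by simp
  then have "sqrt ?p \<le> sqrt ?E / \<delta>"
    using \<open>\<delta> > 0\<close> by (auto dest: real_sqrt_le_mono simp: real_sqrt_divide)
  \<comment> \<open>Only one of the two factors \<open>sqrt ?p\<close> is estimated by Chebyshev;
    the other is kept as the small coefficient.\<close>
  then have "sqrt ?p * sqrt ?p \<le> sqrt ?p * (sqrt ?E / \<delta>)"
    by (intro mult_left_mono) auto
  then have p: "?p \<le> sqrt ?p / \<delta> * sqrt ?E" by simp
  have intD: "integrable M D"
    by (rule integrable_const_bound[where B=2]) (auto simp: D2)
  have intI: "integrable M (indicat_real {x\<in>space M. F x > \<delta>})"
    by (rule integrable_const_bound[where B=1]) auto
  have intB: "integrable M (\<lambda>x. L * F x + 2 * indicat_real {x\<in>space M. F x > \<delta>} x)"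
    using intF intI by (intro Bochner_Integration.integrable_add integrable_mult_right)
  have "\<bar>expectation D\<bar> \<le> expectation (\<lambda>x. norm (D x))"
    using integral_norm_bound[of M D] by simp
  also have "\<dots> \<le> expectation (\<lambda>x. L * F x + 2 * indicat_real {x\<in>space M. F x > \<delta>} x)"
  proof (rule integral_mono[OF integrable_norm[OF intD] intB])
    fix x assume x: "x \<in> space M"
    show "norm (D x) \<le> L * F x + 2 * indicat_real {x\<in>space M. F x > \<delta>} x"
      using D2[OF x] DL[OF x] F0[of x] \<open>L \<ge> 0\<close> x by (auto simp: indicator_def intro: add_increasing)
  qed
  also have "\<dots> = L * expectation F + 2 * ?p"
    using intF intI by (subst Bochner_Integration.integral_add) auto
  also have "\<dots> \<le> L * sqrt ?E + 2 * (sqrt ?p / \<delta> * sqrt ?E)"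
    using EF p \<open>L \<ge> 0\<close> by (intro add_mono mult_left_mono) auto
  finally show ?thesis by (simp add: algebra_simps)
qed

text \<open>The preimage of a rectangle is a box whose remaining sides are the whole space, of mass
  1. This carries a statement about X and one independent copy over to each off-diagonal Gram
  entry.\<close>

lemma (in prob_space) distr_copies_pair:
  assumes i: "i < j" and r: "r < j" and "i \<noteq> r"
  shows "distr (copies_space M j) (M \<Otimes>\<^sub>M M) (\<lambda>\<omega>. (\<omega> i, \<omega> r)) = M \<Otimes>\<^sub>M M"
proof (rule sym, rule pair_measure_eqI)
  interpret C: product_sigma_finite "\<lambda>i::nat. M" ..
  show "sigma_finite_measure M" "sigma_finite_measure M" by unfold_locales
  show "sets (M \<Otimes>\<^sub>M M) = sets (distr (copies_space M j) (M \<Otimes>\<^sub>M M) (\<lambda>\<omega>. (\<omega> i, \<omega> r)))" by simp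
  have m[measurable]: "(\<lambda>\<omega>. (\<omega> i, \<omega> r)) \<in> measurable (copies_space M j) (M \<Otimes>\<^sub>M M)"
    using i r by (intro measurable_Pair measurable_component_singleton) auto
  fix A B assume A: "A \<in> sets M" and B: "B \<in> sets M"
  let ?S = "\<lambda>l. if l = i then A else if l = r then B else space M"
  have "(\<lambda>\<omega>. (\<omega> i, \<omega> r)) -` (A \<times> B) \<inter> space (copies_space M j) = PiE {..<j} ?S"
  proof (rule Set.set_eqI)
    fix \<omega>
    have "\<omega> \<in> PiE {..<j} (\<lambda>_. space M)" if "\<omega> \<in> PiE {..<j} ?S"
      using sets.sets_into_space[OF A] sets.sets_into_space[OF B] that by (intro subsetD[OF PiE_mono that]) auto
    moreover have "\<omega> \<in> PiE {..<j} ?S \<longleftrightarrow> \<omega> i \<in> A \<and> \<omega> r \<in> B" if "\<omega> \<in> PiE {..<j} (\<lambda>_. space M)"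
      using that i r \<open>i \<noteq> r\<close> by (auto simp: PiE_iff)
    ultimately show "\<omega> \<in> (\<lambda>\<omega>. (\<omega> i, \<omega> r)) -` (A \<times> B) \<inter> space (copies_space M j) \<longleftrightarrow> \<omega> \<in> PiE {..<j} ?S"
      unfolding space_PiM by blast
  qed
  then have "emeasure (distr (copies_space M j) (M \<Otimes>\<^sub>M M) (\<lambda>\<omega>. (\<omega> i, \<omega> r))) (A \<times> B) = (\<Prod>l<j. emeasure M (?S l))"
    using A B by (simp add: emeasure_distr m C.emeasure_PiM)
  also have "\<dots> = (\<Prod>l<j. (if l = i then emeasure M A else 1) * (if l = r then emeasure M B else 1))"
    using \<open>i \<noteq> r\<close> by (intro prod.cong) (auto simp: emeasure_space_1)
  also have "\<dots> = emeasure M A * emeasure M B"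
    using i r by (simp add: prod.distrib prod.delta)
  finally show "emeasure M A * emeasure M B = emeasure (distr (copies_space M j) (M \<Otimes>\<^sub>M M) (\<lambda>\<omega>. (\<omega> i, \<omega> r))) (A \<times> B)" ..
qed

text \<open>A union bound over the \<open>j * j\<close> entries suffices, since entries all within
  \<open>\<delta> / j\<close> of their limits give a Frobenius norm of at most
  \<open>\<delta>\<close>. The first convergence hypothesis handles the diagonal and the second the
  remaining entries. The comparison is made for \<open>n \<ge> 1\<close>, where the vectors are
  measurable.\<close>

lemma gram_deviation_tendsto:
  fixes X :: "nat \<Rightarrow> 'a \<Rightarrow> nat \<Rightarrow> real" and j :: nat
  assumes "prob_space M"
    and X: "\<And>n. n \<ge> 1 \<Longrightarrow> X n \<in> measurable M (borel_vec (d n))"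
    and cond1: "tendsto_in_prob (\<lambda>n. M) (\<lambda>n \<omega>. (vnorm (d n) (X n \<omega>))\<^sup>2) c"
    and cond2: "tendsto_in_prob (\<lambda>n. M \<Otimes>\<^sub>M M) (\<lambda>n (\<omega>, \<omega>'). dot (d n) (X n \<omega>) (X n \<omega>')) 0"
    and "j \<ge> 1" "\<delta> > 0"
  shows "(\<lambda>n. measure (copies_space M j) {\<omega> \<in> space (copies_space M j).
    frobenius_norm (gram_matrix (d n) (X n) j \<omega> - c \<cdot>\<^sub>m 1\<^sub>m j) > \<delta>}) \<longlonglongrightarrow> 0"
proof -
  interpret prob_space M by fact
  interpret CC: prob_space "copies_space M j"
    by (rule prob_space_PiM) (rule prob_space_axioms)
  let ?S = "space (copies_space M j)"
  let ?e = "\<lambda>n p \<omega>. dot (d n) (X n (\<omega> (fst p))) (X n (\<omega> (snd p))) - (if fst p = snd p then c else 0)"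
  let ?A = "\<lambda>n p. {\<omega> \<in> ?S. \<bar>?e n p \<omega>\<bar> > \<delta> / j}"
  let ?I = "{..<j} \<times> {..<j}"
  have meas: "?A n p \<in> sets (copies_space M j)" if "p \<in> ?I" "n \<ge> 1" for n p
  proof -
    note [measurable] = X[OF that(2)]
    have [measurable]: "fst p \<in> {..<j}" "snd p \<in> {..<j}" using that by auto
    show ?thesis by measurable
  qed
  have lim: "(\<lambda>n. measure (copies_space M j) (?A n p)) \<longlonglongrightarrow> 0" if p: "p \<in> ?I" for p
  proof (cases p)
    case (Pair i r)
    then have ir: "i < j" "r < j" using p by auto
    show ?thesis
    proof (cases "i = r")
      case True
      have L: "(\<lambda>n. measure M {\<omega>\<in>space M. \<bar>(vnorm (d n) (X n \<omega>))\<^sup>2 - c\<bar> > \<delta> / j}) \<longlonglongrightarrow> 0"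
        using cond1 \<open>\<delta> > 0\<close> \<open>j \<ge> 1\<close> by (simp add: tendsto_in_prob_def)
      have eq: "measure M {\<omega>\<in>space M. \<bar>(vnorm (d n) (X n \<omega>))\<^sup>2 - c\<bar> > \<delta> / j} = measure (copies_space M j) (?A n p)"
        if "n \<ge> 1" for n
      proof -
        note [measurable] = X[OF that]
        have v: "(vnorm (d n) x)\<^sup>2 = dot (d n) x x" for x
          by (simp add: L2_set_def dot_def sum_nonneg power2_eq_square)
        have "measure M {\<omega>\<in>space M. \<bar>(vnorm (d n) (X n \<omega>))\<^sup>2 - c\<bar> > \<delta> / j}
          = measure (distr (copies_space M j) M (\<lambda>\<omega>. \<omega> i)) {\<omega>\<in>space M. \<bar>dot (d n) (X n \<omega>) (X n \<omega>) - c\<bar> > \<delta> / j}"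
          using ir by (subst distr_PiM_component) (auto simp: v prob_space_axioms)
        also have "\<dots> = measure (copies_space M j) ((\<lambda>\<omega>. \<omega> i) -` {\<omega>\<in>space M. \<bar>dot (d n) (X n \<omega>) (X n \<omega>) - c\<bar> > \<delta> / j} \<inter> ?S)"
          using ir by (intro measure_distr measurable_component_singleton) auto
        also have "(\<lambda>\<omega>. \<omega> i) -` {\<omega>\<in>space M. \<bar>dot (d n) (X n \<omega>) (X n \<omega>) - c\<bar> > \<delta> / j} \<inter> ?S = ?A n p"
          using ir unfolding Pair True[symmetric] by (auto simp: space_PiM)
        finally show ?thesis .
      qed
      show ?thesis
        by (rule Lim_transform_eventually[OF L], rule eventually_mono[OF eventually_ge_at_top[of 1]], rule eq)
    next
      case False
      have L: "(\<lambda>n. measure (M \<Otimes>\<^sub>M M) {\<omega>\<in>space (M \<Otimes>\<^sub>M M). \<bar>(case \<omega> of (\<omega>, \<omega>') \<Rightarrow> dot (d n) (X n \<omega>) (X n \<omega>')) - 0\<bar> > \<delta> / j}) \<longlonglongrightarrow> 0"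
        by (rule cond2[unfolded tendsto_in_prob_def, rule_format]) (use \<open>\<delta> > 0\<close> \<open>j \<ge> 1\<close> in simp)
      have eq: "measure (M \<Otimes>\<^sub>M M) {\<omega>\<in>space (M \<Otimes>\<^sub>M M). \<bar>(case \<omega> of (\<omega>, \<omega>') \<Rightarrow> dot (d n) (X n \<omega>) (X n \<omega>')) - 0\<bar> > \<delta> / j}
          = measure (copies_space M j) (?A n p)"
        if "n \<ge> 1" for n
      proof -
        note [measurable] = X[OF that]
        let ?B = "{\<omega>\<in>space (M \<Otimes>\<^sub>M M). \<bar>(case \<omega> of (\<omega>, \<omega>') \<Rightarrow> dot (d n) (X n \<omega>) (X n \<omega>')) - 0\<bar> > \<delta> / j}"
        have "measure (M \<Otimes>\<^sub>M M) ?B = measure (distr (copies_space M j) (M \<Otimes>\<^sub>M M) (\<lambda>\<omega>. (\<omega> i, \<omega> r))) ?B"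
          unfolding distr_copies_pair[OF ir False] ..
        also have "\<dots> = measure (copies_space M j) ((\<lambda>\<omega>. (\<omega> i, \<omega> r)) -` ?B \<inter> ?S)"
          using ir by (intro measure_distr measurable_Pair measurable_component_singleton) auto
        also have "(\<lambda>\<omega>. (\<omega> i, \<omega> r)) -` ?B \<inter> ?S = ?A n p"
          using ir False unfolding Pair by (auto simp: space_PiM space_pair_measure)
        finally show ?thesis .
      qed
      show ?thesis
        by (rule Lim_transform_eventually[OF L], rule eventually_mono[OF eventually_ge_at_top[of 1]], rule eq)
    qed
  qed
  have "(\<lambda>n. \<Sum>p\<in>?I. measure (copies_space M j) (?A n p)) \<longlonglongrightarrow> 0"
    using tendsto_sum[of ?I, OF lim] by simp
  then show ?thesis
  proof (rule tendsto_sandwich[OF _ _ tendsto_const, rotated -1])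
    show "\<forall>\<^sub>F n in sequentially. measure (copies_space M j) {\<omega> \<in> ?S.
      frobenius_norm (gram_matrix (d n) (X n) j \<omega> - c \<cdot>\<^sub>m 1\<^sub>m j) > \<delta>} \<le> (\<Sum>p\<in>?I. measure (copies_space M j) (?A n p))"
      using eventually_ge_at_top[of 1]
    proof eventually_elim
      case (elim n)
      have "{\<omega> \<in> ?S. frobenius_norm (gram_matrix (d n) (X n) j \<omega> - c \<cdot>\<^sub>m 1\<^sub>m j) > \<delta>} \<subseteq> (\<Union>p\<in>?I. ?A n p)"
      proof (rule subsetI, rule ccontr)
        fix \<omega>
        assume F: "\<omega> \<in> {\<omega> \<in> ?S. frobenius_norm (gram_matrix (d n) (X n) j \<omega> - c \<cdot>\<^sub>m 1\<^sub>m j) > \<delta>}"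
          and notin: "\<omega> \<notin> (\<Union>p\<in>?I. ?A n p)"
        have small: "\<bar>?e n p \<omega>\<bar> \<le> \<delta> / j" if "p \<in> ?I" for p
        proof -
          have "\<omega> \<notin> ?A n p" using notin that by blast
          moreover have "\<omega> \<in> ?S" using F by blast
          ultimately show ?thesis by (simp only: mem_Collect_eq not_less simp_thms)
        qed
        have "frobenius_norm (gram_matrix (d n) (X n) j \<omega> - c \<cdot>\<^sub>m 1\<^sub>m j) = sqrt (\<Sum>p\<in>?I. (?e n p \<omega>)\<^sup>2)"
          by (simp add: frobenius_norm_gram_diff sum.cartesian_product split_def)
        also have "\<dots> \<le> sqrt (\<Sum>p\<in>?I. (\<delta> / j)\<^sup>2)"
          using small \<open>\<delta> > 0\<close> by (intro real_sqrt_le_mono sum_mono) (auto simp: abs_le_square_iff[symmetric])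
        also have "\<dots> = \<delta>"
          using \<open>j \<ge> 1\<close> \<open>\<delta> > 0\<close> by (simp add: power_divide power2_eq_square real_sqrt_mult)
        finally show False using F by simp
      qed
      then have "measure (copies_space M j) {\<omega> \<in> ?S. frobenius_norm (gram_matrix (d n) (X n) j \<omega> - c \<cdot>\<^sub>m 1\<^sub>m j) > \<delta>}
        \<le> measure (copies_space M j) (\<Union>p\<in>?I. ?A n p)"
        by (rule CC.finite_measure_mono, intro sets.finite_UN) (simp, rule meas[OF _ elim])
      also have "\<dots> \<le> (\<Sum>p\<in>?I. measure (copies_space M j) (?A n p))"
        by (rule CC.finite_measure_subadditive_finite) (simp, rule image_subsetI, rule meas[OF _ elim])
      finally show ?case .
    qed
  qed auto
qed

section \<open>The constants\<close>

text \<open>Half-integer exponents become powers of square roots. Splitting off one factor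
  \<open>sqrt 2\<close> lets the powers of 2 and \<open>pi\<close> merge into
  \<open>sqrt (2 * pi) ^ j\<close>, which also occurs in the Gaussian integrals.\<close>

lemma normalizing_constant:
  fixes j :: nat
  assumes "\<sigma> > 0" and "j \<ge> 1"
  shows "2 powr (- (real j + 1) / 2) * pi powr (- real j / 2) * real j powr (3 / 2) * \<sigma> powr (- (real j + 2))
    = real j * sqrt (real j) / (sqrt 2 * sqrt (2 * pi) ^ j * \<sigma> ^ (j + 2))"
proof -
  have half: "x powr (- real m / 2) = inverse (sqrt x ^ m)" if "x > 0" for x :: real and m :: nat
  proof -
    have "x powr (- real m / 2) = (x powr (1/2)) powr (- real m)"
      by (simp add: powr_powr)
    also have "\<dots> = inverse (sqrt x ^ m)"
      using that by (simp add: powr_half_sqrt powr_minus powr_realpow)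
    finally show ?thesis .
  qed
  have 1: "2 powr (- (real j + 1) / 2) = inverse (sqrt 2 * sqrt 2 ^ j)"
    using half[of 2 "Suc j"] by (simp add: add.commute)
  have 2: "real j powr (3 / 2) = real j * sqrt (real j)"
  proof -
    have "real j powr (3 / 2) = real j powr (1 + 1 / 2)" by simp
    also have "\<dots> = real j * sqrt (real j)"
      using assms by (simp only: powr_add powr_half_sqrt) simp
    finally show ?thesis .
  qed
  have 3: "\<sigma> powr (- (real j + 2)) = inverse (\<sigma> ^ (j + 2))"
  proof -
    have "\<sigma> powr (- (real j + 2)) = \<sigma> powr (- real (j + 2))" by (simp add: algebra_simps)
    also have "\<dots> = inverse (\<sigma> ^ (j + 2))"
      using assms by (simp only: powr_minus powr_realpow)
    finally show ?thesis .
  qed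
  show ?thesis
    unfolding 1 2 3 half[OF pi_gt_zero] real_sqrt_mult
    by (simp add: power_mult_distrib field_simps)
qed

text \<open>This is the slack. In units of the common factor K the left side is 5/8, namely 1/2
  enlarged by the ratio 5/4, and the right side is \<open>sqrt (real j) / sqrt 2\<close>, which is
  at least \<open>1 / sqrt 2 > 5 / 8\<close>. Any ratio of the powers of s and
  \<open>\<sigma>\<close> strictly between \<open>1 / sqrt 2\<close> and 1 would leave such room;
  4/5 is one choice.\<close>

lemma lipschitz_constant_less:
  fixes j :: nat
  assumes "\<sigma> > 0" and j: "j \<ge> 1" and s: "s > 0" "s ^ (j + 2) = 4 / 5 * \<sigma> ^ (j + 2)" and "y \<noteq> a" and "E > 0"
  shows "(\<bar>y - a\<bar> / (2 * pi)) ^ j * (1 / 2 * (real j * (sqrt (2 * pi) / s) ^ j / s\<^sup>2) * E)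
    < real j * sqrt (real j) / (sqrt 2 * sqrt (2 * pi) ^ j * \<sigma> ^ (j + 2)) * E * \<bar>y - a\<bar> ^ j"
proof -
  define w where "w = sqrt (2 * pi)"
  have w: "w > 0" "2 * pi = w * w" by (simp_all add: w_def)
  define K where "K = real j * E * \<bar>y - a\<bar> ^ j / (w ^ j * \<sigma> ^ (j + 2))"
  have K: "K > 0" using assms w by (simp add: K_def)
  have "(\<bar>y - a\<bar> / (2 * pi)) ^ j * (1 / 2 * (real j * (sqrt (2 * pi) / s) ^ j / s\<^sup>2) * E)
    = real j * E * \<bar>y - a\<bar> ^ j / (w ^ j * (2 * s ^ (j + 2)))"
    unfolding w_def[symmetric] w(2) using w(1) s(1)
    by (simp add: power_divide power_mult_distrib power_add power2_eq_square field_simps)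
  also have "\<dots> = 5 / 8 * K"
    unfolding s(2) K_def by simp
  also have "\<dots> < sqrt (real j) / sqrt 2 * K"
  proof (rule mult_strict_right_mono[OF _ K])
    have "sqrt 2 < 8 / 5" by (rule real_less_lsqrt) (auto simp: power2_eq_square)
    then have "5 / 8 < 1 / sqrt 2" by (simp add: field_simps)
    also have "1 / sqrt 2 \<le> sqrt (real j) / sqrt 2"
      using j by (intro divide_right_mono) auto
    finally show "5 / 8 < sqrt (real j) / sqrt 2" .
  qed
  finally show ?thesis
    unfolding K_def w_def[symmetric] by (simp add: mult_ac)
qed

theorem theorem5p3:
  fixes k j :: nat and \<sigma> y a :: real and d :: "nat \<Rightarrow> nat"
    and M :: "'a measure" and X \<Xi> :: "nat \<Rightarrow> 'a \<Rightarrow> nat \<Rightarrow> real"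
    and N :: "'b measure" and V :: "'b \<Rightarrow> real"
    and \<psi> G :: "real \<Rightarrow> real"
  assumes "k \<ge> 1" and "\<sigma> > 0"
    and d_pos: "\<And>n. n \<ge> 1 \<Longrightarrow> d n \<ge> 1"
    and d_mono: "mono_on {1..} d"
    and d_lim: "filterlim d at_top sequentially"
    and "prob_space M"
    and X_cont: "\<And>n. n \<ge> 1 \<Longrightarrow> continuous_random_vector M (d n) (X n)"
    and cond1: "tendsto_in_prob (\<lambda>n. M) (\<lambda>n \<omega>. (vnorm (d n) (X n \<omega>))\<^sup>2) (\<sigma>\<^sup>2)"
    and cond2: "tendsto_in_prob (\<lambda>n. M \<Otimes>\<^sub>M M) (\<lambda>n (\<omega>, \<omega>'). dot (d n) (X n \<omega>) (X n \<omega>')) 0"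
    and cond3: "\<exists>n0\<ge>1. (\<integral>\<^sup>+\<omega>. inverse (ennreal (sqrt (det (gram_matrix (d n0) (X n0) k \<omega>))))
                        \<partial>copies_space M k) < \<infinity>"
    and cond4: "\<And>n. n \<ge> 1 \<Longrightarrow> AE \<theta> in sphere_measure (d n).
                  (\<integral>\<^sup>+t. ennreal (norm (char_vec M (d n) (X n) (scale_vec (d n) t \<theta>))) \<partial>lborel) < \<infinity>"
    and Xi_cont: "\<And>n. n \<ge> 1 \<Longrightarrow> continuous_random_vector M (d n) (\<Xi> n)"
    and indep: "prob_space.indep_var M
                  (\<Pi>\<^sub>M n\<in>{1..}. borel_vec (d n)) (\<lambda>\<omega>. \<lambda>n\<in>{1..}. X n \<omega>)
                  (\<Pi>\<^sub>M n\<in>{1..}. borel_vec (d n)) (\<lambda>\<omega>. \<lambda>n\<in>{1..}. \<Xi> n \<omega>)"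
    and Xi_symm: "\<And>n. n \<ge> 1 \<Longrightarrow> spherically_symmetric M (d n) (\<Xi> n)"
    and Xi_char: "\<And>n u. n \<ge> 1 \<Longrightarrow> u \<in> space (borel_vec (d n)) \<Longrightarrow>
                  char_vec M (d n) (\<Xi> n) u = complex_of_real (\<psi> ((vnorm (d n) u)\<^sup>2))"
    and G_df: "distribution_function_nonneg G"
    and G_mixing: "\<And>t. \<psi> (t\<^sup>2) = (LINT v:{0..}|interval_measure G. exp (- t\<^sup>2 * v\<^sup>2 / 2))"
    and G_moment: "\<And>n. n \<ge> 1 \<Longrightarrow>
                  (\<integral>\<^sup>+v\<in>{0..}. inverse (ennreal v) ^ d n \<partial>interval_measure G) < \<infinity>"
    and "prob_space N" and "V \<in> borel_measurable N"
    and V_df: "cdf (distr N borel V) = G"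
    and "1 \<le> j" and "j \<le> k"
  shows "\<exists>n\<^sub>j\<ge>1. \<forall>n\<ge>n\<^sub>j.
     (let Y = (\<lambda>\<omega>. dot (d n) (\<Xi> n \<omega>) (X n \<omega>));
          c = 2 powr (- (real j + 1) / 2) * pi powr (- real j / 2) * real j powr (3 / 2)
                * \<sigma> powr (- (real j + 2)) * (LINT \<omega>|N. V \<omega> powi (- int j))
      in ennreal \<bar>(LINT \<omega>|M. (cond_cdf M (d n) (\<Xi> n) Y y \<omega> - cond_cdf M (d n) (\<Xi> n) Y a \<omega>) ^ j)
              - (LINT \<omega>|N. (normal_cdf (\<sigma> * V \<omega>) y - normal_cdf (\<sigma> * V \<omega>) a) ^ j)\<bar>
         \<le> ennreal (c * \<bar>y - a\<bar> ^ j)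
            * ennreal_sqrt (\<integral>\<^sup>+\<omega>. ennreal ((frobenius_norm
                 (gram_matrix (d n) (X n) j \<omega> - \<sigma>\<^sup>2 \<cdot>\<^sub>m 1\<^sub>m j))\<^sup>2) \<partial>copies_space M j))"
proof -
  interpret prob_space M by fact
  interpret N: prob_space N by fact
  interpret CC: prob_space "copies_space M j"
    by (rule prob_space_PiM) (rule prob_space_axioms)
  note [measurable] = \<open>V \<in> borel_measurable N\<close>
  have IG: "interval_measure G = distr N borel V"
    using interval_measure_cdf_distr[OF \<open>prob_space N\<close> \<open>V \<in> borel_measurable N\<close>] by (simp add: V_df)
  have V0: "AE \<omega> in N. 0 \<le> V \<omega>"
    using G_df by (intro AE_nonneg_of_cdf \<open>prob_space N\<close> \<open>V \<in> borel_measurable N\<close>)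
      (simp add: V_df distribution_function_nonneg_def)
  have moment: "(\<integral>\<^sup>+v\<in>{0..}. inverse (ennreal v) ^ d n \<partial>distr N borel V) < \<infinity>" if "n \<ge> 1" for n
    using G_moment[OF that] unfolding IG .
  have Vpos: "AE \<omega> in N. 0 < V \<omega>"
    by (rule AE_pos_of_negative_moment[OF _ V0 d_pos[of 1] moment[of 1]]) auto
  \<comment> \<open>Since the dimensions tend to infinity, some \<open>d m\<close> is at least j,
    and its finite inverse moment controls the one of order \<open>- j\<close>.\<close>
  have "eventually (\<lambda>n. j \<le> d n \<and> 1 \<le> n) sequentially"
    using d_lim by (intro eventually_conj eventually_ge_at_top) (simp add: filterlim_at_top)
  then obtain m where m: "j \<le> d m" "1 \<le> m"
    by (auto dest: eventually_happens)
  have intV: "integrable N (\<lambda>\<omega>. inverse (V \<omega>) ^ j)"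
    by (rule integrable_inverse_power[OF \<open>prob_space N\<close> _ Vpos m(1) moment[OF m(2)]]) simp
  define E where "E = (LINT \<omega>|N. inverse (V \<omega>) ^ j)"
  have EV: "(LINT \<omega>|N. V \<omega> powi (- int j)) = E"
    by (simp add: E_def power_int_minus power_inverse)
  \<comment> \<open>A positive E, together with \<open>y \<noteq> a\<close> below, keeps the
    comparison of constants strict.\<close>
  have "E > 0"
  proof -
    have nonneg: "AE \<omega> in N. 0 \<le> inverse (V \<omega>) ^ j"
      using Vpos by eventually_elim simp
    have "E \<noteq> 0"
    proof
      assume "E = 0"
      then have "AE \<omega> in N. inverse (V \<omega>) ^ j = 0"
        unfolding E_def using integral_nonneg_eq_0_iff_AE[OF intV nonneg] by blast
      with Vpos have "AE \<omega> in N. False" by eventually_elim simp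
      then show False by (simp add: N.AE_False)
    qed
    moreover have "E \<ge> 0" unfolding E_def using nonneg by (rule integral_nonneg_AE)
    ultimately show ?thesis by simp
  qed
  \<comment> \<open>As G is the distribution function of V, the mixing integral at
    \<open>t = sqrt q\<close> becomes an expectation over N.\<close>
  have psi: "\<psi> q = (LINT \<omega>|N. exp (- (V \<omega>)\<^sup>2 * q / 2))" if "0 \<le> q" for q
  proof -
    have "\<psi> q = (LINT v:{0..}|distr N borel V. exp (- q * v\<^sup>2 / 2))"
      using G_mixing[of "sqrt q"] that by (simp add: IG)
    also have "\<dots> = (LINT \<omega>|N. indicat_real {0..} (V \<omega>) *\<^sub>R exp (- q * (V \<omega>)\<^sup>2 / 2))"
      unfolding set_lebesgue_integral_def by (rule integral_distr) measurable
    also have "\<dots> = (LINT \<omega>|N. exp (- (V \<omega>)\<^sup>2 * q / 2))"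
      using V0 by (intro integral_cong_AE) (auto elim!: eventually_mono simp: mult.commute)
    finally show ?thesis .
  qed
  have ind: "indep_var (borel_vec (d n)) (X n) (borel_vec (d n)) (\<Xi> n)" if "n \<ge> 1" for n
  proof -
    have "(\<lambda>f. f n) \<in> measurable (\<Pi>\<^sub>M n\<in>{1..}. borel_vec (d n)) (borel_vec (d n))"
      using that by (intro measurable_component_singleton) simp
    from indep_var_compose[OF indep this this] show ?thesis
      using that by (simp add: comp_def)
  qed
  have Xm: "X n \<in> measurable M (borel_vec (d n))" and Xim: "\<Xi> n \<in> measurable M (borel_vec (d n))" if "n \<ge> 1" for n
    using ind[OF that] by (auto simp: indep_var_distribution_eq)
  have char: "(CLINT \<omega>|M. iexp (\<Sum>i<j. t i * dot (d n) (\<Xi> n \<omega>) (x i)))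
      = complex_of_real (LINT \<omega>|N. exp (- (V \<omega>)\<^sup>2 * gram_form (d n) j x t / 2))" if "n \<ge> 1" for n t x
    unfolding char_linear_combination_dot
    by (subst Xi_char[OF that]) (auto simp: space_PiM psi gram_form_def)
  show ?thesis
  proof (cases "y = a")
    \<comment> \<open>Both sides are 0 here, because \<open>j \<ge> 1\<close>; this case is
      separated because the constants leave no slack in it.\<close>
    case True
    then show ?thesis using \<open>1 \<le> j\<close> by (intro exI[of _ 1]) (simp add: Let_def power_0_left)
  next
    case False
    \<comment> \<open>The radius is slightly below \<open>\<sigma>\<close>: the loss in the
      Lipschitz constant stays within the slack, while \<open>\<sigma>\<^sup>2 - s\<^sup>2\<close>
      is positive and serves as the truncation threshold \<open>\<delta>\<close>.\<close>
    define s where "s = \<sigma> * root (j + 2) (4 / 5)"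
    have s: "s > 0" "s ^ (j + 2) = 4 / 5 * \<sigma> ^ (j + 2)" "s < \<sigma>"
      using \<open>\<sigma> > 0\<close> by (auto simp: s_def power_mult_distrib real_root_pow_pos simp del: power_Suc)
    define \<delta> where "\<delta> = \<sigma>\<^sup>2 - s\<^sup>2"
    have "\<delta> > 0" using s \<open>\<sigma> > 0\<close> by (simp add: \<delta>_def power_strict_mono)
    define c where "c = 2 powr (- (real j + 1) / 2) * pi powr (- real j / 2) * real j powr (3 / 2)
      * \<sigma> powr (- (real j + 2)) * E * \<bar>y - a\<bar> ^ j"
    define L where "L = (\<bar>y - a\<bar> / (2 * pi)) ^ j * (1 / 2 * (real j * (sqrt (2 * pi) / s) ^ j / s\<^sup>2) * E)"
    have "L < c"
      unfolding L_def c_def normalizing_constant[OF \<open>\<sigma> > 0\<close> \<open>1 \<le> j\<close>]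
      by (rule lipschitz_constant_less) fact+
    have "L \<ge> 0" using s \<open>E > 0\<close> by (simp add: L_def)
    define C where "C = (LINT \<omega>|N. (normal_cdf (\<sigma> * V \<omega>) y - normal_cdf (\<sigma> * V \<omega>) a) ^ j)"
    define F where "F n \<omega> = frobenius_norm (gram_matrix (d n) (X n) j \<omega> - \<sigma>\<^sup>2 \<cdot>\<^sub>m 1\<^sub>m j)" for n \<omega>
    define D where "D n \<omega> = (LINT \<omega>'|M. (\<Prod>i<j. cdf_step a y (dot (d n) (\<Xi> n \<omega>') (X n (\<omega> i))))) - C" for n \<omega>
    define p where "p n = CC.prob {\<omega> \<in> space (copies_space M j). F n \<omega> > \<delta>}" for n
    have "p \<longlonglongrightarrow> 0"
      unfolding p_def F_def
      by (rule gram_deviation_tendsto[OF \<open>prob_space M\<close> Xm cond1 cond2 \<open>1 \<le> j\<close> \<open>\<delta> > 0\<close>])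
    \<comment> \<open>The coefficient from the truncation tends to \<open>L < c\<close>. From some
      index on it is below c, and this determines the index claimed in the theorem.\<close>
    then have "(\<lambda>n. L + 2 * sqrt (p n) / \<delta>) \<longlonglongrightarrow> L + 2 * sqrt 0 / \<delta>"
      by (intro tendsto_intros) (use \<open>\<delta> > 0\<close> in auto)
    then have "eventually (\<lambda>n. L + 2 * sqrt (p n) / \<delta> < c) sequentially"
      using \<open>L < c\<close> by (intro order_tendstoD(2)) auto
    then obtain n0 where n0: "\<And>n. n \<ge> n0 \<Longrightarrow> L + 2 * sqrt (p n) / \<delta> < c"
      by (auto simp: eventually_sequentially)
    \<comment> \<open>No measurability of Z is assumed: if the product is not integrable, its
      integral has the default value 0 and the bound still holds.\<close>
    have step_bound: "\<bar>LINT \<omega>|P. (\<Prod>i<j. cdf_step a y (Z i \<omega>))\<bar> \<le> 1"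
      if "prob_space P" for P :: "'c measure" and Z
    proof -
      interpret P: prob_space P by fact
      have "\<bar>LINT \<omega>|P. (\<Prod>i<j. cdf_step a y (Z i \<omega>))\<bar> \<le> (LINT \<omega>|P. \<bar>\<Prod>i<j. cdf_step a y (Z i \<omega>)\<bar>)"
        by (rule integral_abs_bound)
      also have "\<dots> \<le> 1"
        by (cases "integrable P (\<lambda>\<omega>. \<bar>\<Prod>i<j. cdf_step a y (Z i \<omega>)\<bar>)")
          (auto intro!: P.integral_le_const prod_le_1 simp: abs_prod abs_step_le not_integrable_integral_eq)
      finally show ?thesis .
    qed
    have C1: "\<bar>C\<bar> \<le> 1"
    proof -
      have S: "prob_space std_normal_distribution"
        by (rule prob_space_normal_density) simp
      show ?thesis
        unfolding C_def step_normal_mixture[OF \<open>prob_space N\<close> \<open>V \<in> borel_measurable N\<close> Vpos \<open>\<sigma> > 0\<close>, symmetric]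
        by (intro step_bound prob_space_pair prob_space_PiM \<open>prob_space N\<close> S)
    qed
    have key: "ennreal \<bar>(LINT \<omega>|M. (cond_cdf M (d n) (\<Xi> n) (\<lambda>\<omega>. dot (d n) (\<Xi> n \<omega>) (X n \<omega>)) y \<omega>
          - cond_cdf M (d n) (\<Xi> n) (\<lambda>\<omega>. dot (d n) (\<Xi> n \<omega>) (X n \<omega>)) a \<omega>) ^ j) - C\<bar>
        \<le> ennreal c * ennreal_sqrt (\<integral>\<^sup>+\<omega>. ennreal ((F n \<omega>)\<^sup>2) \<partial>copies_space M j)"
      if n: "n \<ge> max 1 n0" for n
    proof (cases "(\<integral>\<^sup>+\<omega>. ennreal ((F n \<omega>)\<^sup>2) \<partial>copies_space M j) = \<infinity>")
      case True
      \<comment> \<open>If the second moment is infinite, the right side is infinite only because c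
        is nonzero: in \<open>ennreal\<close>, 0 times infinity is 0.\<close>
      have "c > 0" using \<open>L < c\<close> \<open>L \<ge> 0\<close> by simp
      then show ?thesis unfolding True by (simp add: ennreal_sqrt_def ennreal_mult_top)
    next
      case False
      have n1: "n \<ge> 1" using n by simp
      note [measurable] = Xm[OF n1] Xim[OF n1]
      have Fm[measurable]: "F n \<in> borel_measurable (copies_space M j)"
        unfolding F_def frobenius_norm_gram_diff by measurable
      have F0: "0 \<le> F n \<omega>" for \<omega>
        unfolding F_def frobenius_norm_gram_diff by (intro real_sqrt_ge_zero sum_nonneg) auto
      have intF: "integrable (copies_space M j) (\<lambda>\<omega>. (F n \<omega>)\<^sup>2)"
        by (rule integrableI_nonneg) (use False in \<open>auto simp: less_top\<close>)
      have nnF: "(\<integral>\<^sup>+\<omega>. ennreal ((F n \<omega>)\<^sup>2) \<partial>copies_space M j) = ennreal (CC.expectation (\<lambda>\<omega>. (F n \<omega>)\<^sup>2))"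
        by (rule nn_integral_eq_integral[OF intF]) simp
      have inner: "(\<lambda>\<omega>. LINT \<omega>'|M. (\<Prod>i<j. cdf_step a y (dot (d n) (\<Xi> n \<omega>') (X n (\<omega> i))))) \<in> borel_measurable (copies_space M j)"
        by measurable
      have Dm: "D n \<in> borel_measurable (copies_space M j)"
        unfolding D_def by (intro borel_measurable_diff inner) simp
      have DL: "\<bar>D n \<omega>\<bar> \<le> L * F n \<omega>" if \<omega>: "\<omega> \<in> space (copies_space M j)" and "F n \<omega> \<le> \<delta>" for \<omega>
      proof -
        \<comment> \<open>With the copies frozen, the comparison is applied with b equal to
          \<open>F n \<omega>\<close>; its requirement
          \<open>b \<le> \<sigma>\<^sup>2 - s\<^sup>2\<close> is exactly
          \<open>F n \<omega> \<le> \<delta>\<close>.\<close>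
        have "\<bar>D n \<omega>\<bar> \<le> (\<bar>y - a\<bar> / (2 * pi)) ^ j * (F n \<omega> / 2 * (real j * (sqrt (2 * pi) / s) ^ j / s\<^sup>2) * (LINT \<omega>|N. inverse (V \<omega>) ^ j))"
          unfolding D_def C_def
        proof (rule step_expectation_normal_mixture_bound[where Q="gram_form (d n) j (\<lambda>i. X n (\<omega> i))"])
          fix i assume "i < j"
          then have "\<omega> i \<in> space M" using \<omega> by (auto simp: space_PiM)
          then have "X n (\<omega> i) \<in> space (borel_vec (d n))" by (rule measurable_space[OF Xm[OF n1]])
          then show "(\<lambda>\<omega>'. dot (d n) (\<Xi> n \<omega>') (X n (\<omega> i))) \<in> borel_measurable M" by measurable
        next
          show "F n \<omega> \<le> \<sigma>\<^sup>2 - s\<^sup>2" using \<open>F n \<omega> \<le> \<delta>\<close> by (simp add: \<delta>_def)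
        next
          fix t
          show "\<bar>gram_form (d n) j (\<lambda>i. X n (\<omega> i)) t - \<sigma>\<^sup>2 * (\<Sum>i<j. (t i)\<^sup>2)\<bar> \<le> F n \<omega> * (\<Sum>i<j. (t i)\<^sup>2)"
            unfolding F_def by (rule gram_form_diff_le)
        qed (fact \<open>prob_space M\<close> \<open>prob_space N\<close> \<open>V \<in> borel_measurable N\<close> Vpos intV \<open>\<sigma> > 0\<close> s(1) F0 gram_form_measurable char[OF n1])+
        then show ?thesis by (simp add: L_def E_def mult_ac)
      qed
      have D2: "\<bar>D n \<omega>\<bar> \<le> 2" for \<omega>
        using C1 step_bound[OF \<open>prob_space M\<close>, of "\<lambda>i \<omega>'. dot (d n) (\<Xi> n \<omega>') (X n (\<omega> i))"]
        unfolding D_def by linarith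
      have "(LINT \<omega>|M. (cond_cdf M (d n) (\<Xi> n) (\<lambda>\<omega>. dot (d n) (\<Xi> n \<omega>) (X n \<omega>)) y \<omega>
          - cond_cdf M (d n) (\<Xi> n) (\<lambda>\<omega>. dot (d n) (\<Xi> n \<omega>) (X n \<omega>)) a \<omega>) ^ j) - C = CC.expectation (D n)"
      proof -
        have "integrable (copies_space M j) (\<lambda>\<omega>. LINT \<omega>'|M. (\<Prod>i<j. cdf_step a y (dot (d n) (\<Xi> n \<omega>') (X n (\<omega> i)))))"
          by (rule CC.integrable_const_bound[where B=1, OF _ inner])
            (simp add: step_bound[OF \<open>prob_space M\<close>])
        then show ?thesis
          unfolding expectation_cond_cdf_diff_power[OF ind[OF n1]] D_def
          by (simp add: CC.prob_space)
      qed
      also have "\<bar>\<dots>\<bar> \<le> (L + 2 * sqrt (p n) / \<delta>) * sqrt (CC.expectation (\<lambda>\<omega>. (F n \<omega>)\<^sup>2))"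
        unfolding p_def
        by (rule CC.truncation_bound[OF Dm Fm F0 intF D2 DL \<open>\<delta> > 0\<close> \<open>L \<ge> 0\<close>])
      also have "\<dots> \<le> c * sqrt (CC.expectation (\<lambda>\<omega>. (F n \<omega>)\<^sup>2))"
        using n0[of n] n by (intro mult_right_mono) auto
      finally show ?thesis
        unfolding nnF using \<open>L < c\<close> \<open>L \<ge> 0\<close>
        by (simp add: ennreal_sqrt_def ennreal_mult'[symmetric] ennreal_leI)
    qed
    show ?thesis
      unfolding Let_def EV
      using key unfolding C_def F_def c_def
      by (intro exI[of _ "max 1 n0"] conjI allI impI) (simp_all only: max.cobounded1)
  qed
qed

end
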